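(* Let $n\ge 2$ be an integer. Consider, in the Newtonian planar $N$-body problem with $N=1+3n$, configurations of the following type: a central body of mass $m_0$ at the origin; a regular $n$-gon with vertices $\rho\, e^{2\pi i l/n}$, $l=0,\dots,n-1$ ($\rho>0$), each of mass $m_1$; and a regular $2n$-gon with vertices $e^{i\pi l/n}$, $l=0,\dots,2n-1$, whose masses are alternately $m_2$ (for even $l$) and $m_3$ (for odd $l$). (So the two polygons have the same symmetry axes.) For every $n\ge 237$ there exists a really perverse relative equilibrium of this type, and all the masses can be chosen to be positive. For $n\le 236$ no really perverse relative equilibrium of this type exists.
   Context: The Newtonian planar $N$-body problem (gravitational constant $1$): bodies with masses $\mu_i>0$ at positions $r_i\in\mathbb{C}$ satisfy $\mu_i\ddot r_i=\sum_{j\ne i}\mu_i\mu_j\,\frac{r_j-r_i}{|r_j-r_i|^3}$. A relative equilibrium (with angular velocity $1$) of a configuration $(r_1,\dots,r_N)$ is the motion $r_i(t)=r_i e^{it}$, when it is a solution. A mass system for the configuration type above is a vector $(m_0,m_1,m_2,m_3)$ of positive numbers, assigned as described; its total mass is $M=m_0+n(m_1+m_2+m_3)$ and its center of mass is then at the origin. The relative equilibrium $r_i(t)=r_ie^{it}$ is called really perverse if there exist two distinct mass systems with the same total mass and the same center of mass such that $r_i(t)=r_ie^{it}$ is a solution of the equations of motion for each of them. *)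

theory Defs
  imports Complex_Main
begin

definition nbody_solution :: "nat \<Rightarrow> (nat \<Rightarrow> real) \<Rightarrow> (nat \<Rightarrow> real \<Rightarrow> complex) \<Rightarrow> bool" where
  "nbody_solution N mu q \<longleftrightarrow>
     (\<exists>v a. \<forall>i<N. \<forall>t.
        (q i has_vector_derivative v i t) (at t) \<and>
        (v i has_vector_derivative a i t) (at t) \<and>
        of_real (mu i) * a i t =
          (\<Sum>j\<in>{..<N} - {i}. of_real (mu i * mu j) * (q j t - q i t)
                                 / of_real (cmod (q j t - q i t) ^ 3)))"

definition is_config :: "nat \<Rightarrow> (nat \<Rightarrow> complex) \<Rightarrow> bool" where
  "is_config N r \<longleftrightarrow> inj_on r {..<N}"

definition is_rel_eq :: "nat \<Rightarrow> (nat \<Rightarrow> real) \<Rightarrow> (nat \<Rightarrow> complex) \<Rightarrow> bool" where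
  "is_rel_eq N mu r \<longleftrightarrow> nbody_solution N mu (\<lambda>i t. r i * cis t)"

definition total_mass :: "nat \<Rightarrow> (nat \<Rightarrow> real) \<Rightarrow> real" where
  "total_mass N mu = (\<Sum>i<N. mu i)"

definition center_of_mass :: "nat \<Rightarrow> (nat \<Rightarrow> real) \<Rightarrow> (nat \<Rightarrow> complex) \<Rightarrow> complex" where
  "center_of_mass N mu r = (\<Sum>i<N. of_real (mu i) * r i) / of_real (total_mass N mu)"

text \<open>The configuration type, N = 1 + 3n: index 0 is the centre (origin);
indices 1..n are the n-gon vertices rho e^{2 pi i l/n}, l = i-1;
indices n+1..3n are the 2n-gon vertices e^{i pi l/n}, l = i-n-1.\<close>
definition cfg_pos :: "nat \<Rightarrow> real \<Rightarrow> nat \<Rightarrow> complex" where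
  "cfg_pos n \<rho> i =
     (if i = 0 then 0
      else if i \<le> n then complex_of_real \<rho> * cis (2 * pi * real (i - 1) / real n)
      else cis (pi * real (i - n - 1) / real n))"

definition cfg_mass :: "nat \<Rightarrow> real \<times> real \<times> real \<times> real \<Rightarrow> nat \<Rightarrow> real" where
  "cfg_mass n m i = (case m of (m0, m1, m2, m3) \<Rightarrow>
     (if i = 0 then m0 else if i \<le> n then m1
      else if even (i - n - 1) then m2 else m3))"

definition mass_system :: "real \<times> real \<times> real \<times> real \<Rightarrow> bool" where
  "mass_system m \<longleftrightarrow> (case m of (m0, m1, m2, m3) \<Rightarrow> m0 > 0 \<and> m1 > 0 \<and> m2 > 0 \<and> m3 > 0)"

definition really_perverse :: "nat \<Rightarrow> real \<Rightarrow> bool" where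
  "really_perverse n \<rho> \<longleftrightarrow>
     (let N = 1 + 3 * n; r = cfg_pos n \<rho> in
       is_config N r \<and>
       (\<exists>m m'. mass_system m \<and> mass_system m' \<and> m \<noteq> m' \<and>
          total_mass N (cfg_mass n m) = total_mass N (cfg_mass n m') \<and>
          center_of_mass N (cfg_mass n m) r = center_of_mass N (cfg_mass n m') r \<and>
          is_rel_eq N (cfg_mass n m) r \<and> is_rel_eq N (cfg_mass n m') r))"

end

theory Submission
  imports Defs "HOL-Analysis.Analysis"
begin

text \<open>
  By symmetry the equations of motion reduce to three real equations, linear in the masses, whose
  coefficients are the radial attractions \<open>G\<^sub>\<plusminus>(x)\<close> of the polygons \<open>z\<^sup>n = \<plusminus>1\<close> scaled by \<open>x\<close>,
  acting on the point \<open>1\<close>, at \<open>x = 1\<close>, \<open>\<rho>\<close> and \<open>1/\<rho>\<close>. Put \<open>A = G\<^sub>+(1)\<close>, \<open>B = G\<^sub>-(1)\<close>,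
  \<open>P = G\<^sub>+ + G\<^sub>-\<close> and \<open>Q = G\<^sub>+ - G\<^sub>-\<close>. A difference of two mass systems with the same total mass solves a
  homogeneous system with determinant proportional to
  \<open>(2A - 2n + Q(\<rho>)Q(1/\<rho>)/(B - A)) (A + B - 2n) - (P(\<rho>) - 2n) (P(1/\<rho>) - 2n)\<close>.
  Expanding \<open>(1 - w)/\<bar>1 - w\<bar>\<^sup>3\<close> as the product of \<open>(1 - w)\<close> to the power \<open>-1/2\<close> and \<open>(1 - cnj w)\<close>
  to the power \<open>-3/2\<close> gives power series with nonnegative coefficients, hence \<open>P > 2n\<close>, \<open>Q > 0\<close> on \<open>(0,1)\<close> and
  \<open>P < 0\<close>, \<open>Q < 0\<close> on \<open>(1,\<infinity>)\<close>. So the determinant is positive if \<open>A + B < 2n\<close> (as \<open>A < B\<close>). If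
  \<open>A + B > 2n\<close> and \<open>A \<noteq> n\<close>, it takes values of opposite sign near \<open>\<rho> = 0\<close> and \<open>\<rho> = 1\<close>, and at a zero
  in \<open>(0,1)\<close> the solutions with small \<open>m\<^sub>1 > 0\<close> are positive.

  Finally \<open>4A\<close> and \<open>4(A + B)\<close> are the sums of \<open>csc (\<pi>l/N)\<close>, \<open>0 < l < N\<close>, for \<open>N = n\<close> and \<open>N = 2n\<close>; such
  a sum is about \<open>(2N/\<pi>) (ln (2N/\<pi>) + \<gamma>)\<close>, which crosses \<open>4N\<close> between \<open>N = 472\<close> and \<open>N = 473\<close>.
\<close>

section \<open>Sums of cosecants\<close>

lemma has_real_derivative_ln_tan_half:
  fixes x :: real
  assumes "0 < x" "x < pi"
  shows "((\<lambda>x. ln (tan (x / 2))) has_real_derivative 1 / sin x) (at x)"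
proof -
  have c: "cos (x / 2) > 0" and s: "sin (x / 2) > 0"
    using assms by (auto intro!: cos_gt_zero sin_gt_zero)
  have t: "tan (x / 2) > 0"
    using c s by (simp add: tan_def)
  have "sin x = 2 * sin (x / 2) * cos (x / 2)"
    using sin_double[of "x / 2"] by simp
  then show ?thesis
    using c s t by (auto intro!: derivative_eq_intros simp: tan_def field_simps power2_eq_square)
qed

lemma ln_tan_half_pi_minus:
  fixes x :: real
  assumes "0 < x" "x < pi"
  shows "ln (tan ((pi - x) / 2)) = - ln (tan (x / 2))"
proof -
  have "tan ((pi - x) / 2) = inverse (tan (x / 2))"
    using tan_cot[of "x / 2"] by (simp add: diff_divide_distrib)
  moreover have "tan (x / 2) > 0"
    using assms by (intro tan_gt_zero) auto
  ultimately show ?thesis by (simp add: ln_inverse)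
qed

text \<open>This is midpoint convexity of the cosecant. The sum of the two reciprocals is the sum of
  the sines, \<open>2 sin x cos h\<close>, over their product,
  \<open>sin\<^sup>2 x - sin\<^sup>2 h\<close>, and the product is at most
  \<open>sin\<^sup>2 x cos h\<close>.\<close>

lemma csc_midpoint:
  fixes x h :: real
  assumes "0 \<le> h" "0 < x - h" "x + h < pi"
  shows "2 / sin x \<le> 1 / sin (x + h) + 1 / sin (x - h)"
proof -
  have pos: "sin x > 0" "sin (x + h) > 0" "sin (x - h) > 0"
    using assms by (auto intro!: sin_gt_zero)
  have h: "cos h > 0" using assms by (intro cos_gt_zero_pi) auto
  have prod: "sin (x + h) * sin (x - h) = (sin x)\<^sup>2 - (sin h)\<^sup>2"
  proof -
    have "sin (x + h) * sin (x - h) = (sin x)\<^sup>2 * (cos h)\<^sup>2 - (cos x)\<^sup>2 * (sin h)\<^sup>2"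
      by (simp add: sin_add sin_diff algebra_simps power2_eq_square)
    then show ?thesis unfolding cos_squared_eq by (simp add: algebra_simps)
  qed
  have "(sin x)\<^sup>2 * (1 - cos h) \<le> 1 * (1 - cos h)"
    by (intro mult_right_mono) (auto simp: abs_square_le_1)
  also have "\<dots> \<le> (1 - cos h) * (1 + cos h)"
    using h by (auto simp: algebra_simps intro: mult_left_le)
  also have "\<dots> = (sin h)\<^sup>2"
    by (simp add: sin_squared_eq algebra_simps power2_eq_square)
  finally have "sin (x + h) * sin (x - h) \<le> (sin x)\<^sup>2 * cos h"
    unfolding prod by (simp add: algebra_simps)
  then have "2 * (sin (x + h) * sin (x - h)) \<le> sin x * (sin (x + h) + sin (x - h))"
    by (simp add: sin_add sin_diff power2_eq_square algebra_simps)
  then show ?thesis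
    using pos by (simp add: field_simps)
qed

text \<open>Both sides vanish at \<open>h = 0\<close>, and the derivative of their difference in
  \<open>h\<close> is the defect in \<open>csc_midpoint\<close>.\<close>

lemma csc_midpoint_integral:
  fixes x h :: real
  assumes "0 \<le> h" "0 < x - h" "x + h < pi"
  shows "2 * h / sin x \<le> ln (tan ((x + h) / 2)) - ln (tan ((x - h) / 2))"
proof -
  let ?f = "\<lambda>t. ln (tan ((x + t) / 2)) - ln (tan ((x - t) / 2)) - 2 * t / sin x"
  have "?f 0 \<le> ?f h"
  proof (rule DERIV_nonneg_imp_nondecreasing[OF assms(1)])
    fix t assume t: "0 \<le> t" "t \<le> h"
    have "((\<lambda>t. ln (tan ((x + t) / 2))) has_real_derivative 1 / sin (x + t)) (at t)"
    proof -
      have "((\<lambda>t. x + t) has_real_derivative 1) (at t)" by (auto intro!: derivative_eq_intros)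
      from DERIV_chain2[OF has_real_derivative_ln_tan_half this] show ?thesis
        using t assms by simp
    qed
    moreover have "((\<lambda>t. ln (tan ((x - t) / 2))) has_real_derivative - 1 / sin (x - t)) (at t)"
    proof -
      have "((\<lambda>t. x - t) has_real_derivative - 1) (at t)" by (auto intro!: derivative_eq_intros)
      from DERIV_chain2[OF has_real_derivative_ln_tan_half this] show ?thesis
        using t assms by simp
    qed
    ultimately have "(?f has_real_derivative 1 / sin (x + t) - (- 1 / sin (x - t)) - 2 / sin x) (at t)"
      using assms sin_gt_zero[of x] by (intro DERIV_diff) (auto intro!: derivative_eq_intros)
    moreover have "0 \<le> 1 / sin (x + t) - (- 1 / sin (x - t)) - 2 / sin x"
      using csc_midpoint[of t x] t assms by auto
    ultimately show "\<exists>y. (?f has_real_derivative y) (at t) \<and> 0 \<le> y" by blast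
  qed
  then show ?thesis by simp
qed

text \<open>Convexity again, now as monotonicity of the derivative of \<open>csc\<close>. After
  clearing denominators the difference factors as
  \<open>(cos x - cos y) (1 + cos x cos y)\<close>.\<close>

lemma csc_derivative_mono:
  fixes x y :: real
  assumes "0 < x" "x \<le> y" "y < pi"
  shows "cos y / (sin y)\<^sup>2 \<le> cos x / (sin x)\<^sup>2"
proof -
  have pos: "sin x > 0" "sin y > 0"
    using assms by (auto intro!: sin_gt_zero)
  have c: "cos y \<le> cos x" using assms by (intro cos_monotone_0_pi_le) auto
  have "\<bar>cos x * cos y\<bar> \<le> 1 * 1"
    unfolding abs_mult by (intro mult_mono) auto
  then have "0 \<le> (cos x - cos y) * (1 + cos x * cos y)"
    using c by (intro mult_nonneg_nonneg) auto
  then have "cos y * (sin x)\<^sup>2 \<le> cos x * (sin y)\<^sup>2"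
    unfolding sin_squared_eq by (simp add: algebra_simps power2_eq_square)
  then show ?thesis using pos by (simp add: field_simps)
qed

text \<open>Differentiating the difference of the two sides in \<open>h\<close>, the cosecants
  cancel; what remains is \<open>h\<close> times an increment of the derivative of
  \<open>csc\<close>.\<close>

lemma csc_trapezoid_integral:
  fixes x h :: real
  assumes "0 \<le> h" "0 < x - h" "x + h < pi"
  shows "ln (tan ((x + h) / 2)) - ln (tan ((x - h) / 2)) \<le> h * (1 / sin (x + h) + 1 / sin (x - h))"
proof -
  let ?f = "\<lambda>t. t * (1 / sin (x + t) + 1 / sin (x - t)) - (ln (tan ((x + t) / 2)) - ln (tan ((x - t) / 2)))"
  have "?f 0 \<le> ?f h"
  proof (rule DERIV_nonneg_imp_nondecreasing[OF assms(1)])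
    fix t assume t: "0 \<le> t" "t \<le> h"
    have s: "sin (x + t) > 0" "sin (x - t) > 0"
      using t assms by (auto intro!: sin_gt_zero)
    have "((\<lambda>t. ln (tan ((x + t) / 2))) has_real_derivative 1 / sin (x + t)) (at t)"
    proof -
      have "((\<lambda>t. x + t) has_real_derivative 1) (at t)" by (auto intro!: derivative_eq_intros)
      from DERIV_chain2[OF has_real_derivative_ln_tan_half this] show ?thesis
        using t assms by simp
    qed
    moreover have "((\<lambda>t. ln (tan ((x - t) / 2))) has_real_derivative - 1 / sin (x - t)) (at t)"
    proof -
      have "((\<lambda>t. x - t) has_real_derivative - 1) (at t)" by (auto intro!: derivative_eq_intros)
      from DERIV_chain2[OF has_real_derivative_ln_tan_half this] show ?thesis
        using t assms by simp
    qed
    moreover have "((\<lambda>t. 1 / sin (x + t)) has_real_derivative - cos (x + t) / (sin (x + t))\<^sup>2) (at t)"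
      using s by (auto intro!: derivative_eq_intros simp: power2_eq_square)
    moreover have "((\<lambda>t. 1 / sin (x - t)) has_real_derivative cos (x - t) / (sin (x - t))\<^sup>2) (at t)"
      using s by (auto intro!: derivative_eq_intros simp: power2_eq_square)
    ultimately have "(?f has_real_derivative
        (1 * (1 / sin (x + t) + 1 / sin (x - t)) + (- cos (x + t) / (sin (x + t))\<^sup>2 + cos (x - t) / (sin (x - t))\<^sup>2) * t)
         - (1 / sin (x + t) - (- 1 / sin (x - t)))) (at t)"
      by (intro DERIV_diff DERIV_mult DERIV_add DERIV_ident)
    moreover have "0 \<le> (- cos (x + t) / (sin (x + t))\<^sup>2 + cos (x - t) / (sin (x - t))\<^sup>2) * t"
      using csc_derivative_mono[of "x - t" "x + t"] t assms by (intro mult_nonneg_nonneg) auto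
    ultimately show "\<exists>y. (?f has_real_derivative y) (at t) \<and> 0 \<le> y"
      by (intro exI conjI) auto
  qed
  then show ?thesis by simp
qed

definition csc_sum :: "nat \<Rightarrow> real" where
  "csc_sum N = (\<Sum>l=1..N - 1. 1 / sin (pi * real l / real N))"

lemma csc_sum_split:
  fixes L N :: nat
  assumes "1 \<le> L" "2 * L \<le> N"
  shows "csc_sum N = 2 * (\<Sum>l=1..L - 1. 1 / sin (pi * real l / real N))
           + (\<Sum>l=L..N - L. 1 / sin (pi * real l / real N))"
proof -
  let ?f = "\<lambda>l. 1 / sin (pi * real l / real N)"
  have set: "{1..N - 1} = {1..L - 1} \<union> ({L..N - L} \<union> {N - L + 1..N - 1})"
    using assms by auto
  have "csc_sum N = sum ?f {1..L - 1} + (sum ?f {L..N - L} + sum ?f {N - L + 1..N - 1})"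
    unfolding csc_sum_def set using assms
    by (subst sum.union_disjoint; force?)+
  also have "sum ?f {N - L + 1..N - 1} = sum ?f {1..L - 1}"
  proof (rule sum.reindex_bij_witness[of _ "\<lambda>l. N - l" "\<lambda>l. N - l"])
    fix l assume l: "l \<in> {N - L + 1..N - 1}"
    then have "real (N - l) = real N - real l" "N > 0"
      using assms by (auto intro: of_nat_diff)
    then have "pi * real (N - l) / real N = pi - pi * real l / real N"
      by (simp add: field_simps)
    then show "?f (N - l) = ?f l" by simp
  qed (use assms in auto)
  finally show ?thesis by simp
qed

text \<open>
  The primitive of \<open>csc\<close> is \<open>ln (tan (x/2))\<close> and \<open>csc\<close> is convex, so the midpoint and the trapezoidal
  rule bound the sum on either side. They are too coarse near the poles, where \<open>L - 1\<close> terms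
  at each end are kept.
\<close>

lemma csc_sum_upper:
  fixes L N :: nat
  assumes "1 \<le> L" "2 * L \<le> N"
  shows "pi / N * csc_sum N \<le> 2 * (\<Sum>l=1..L - 1. pi / N / sin (pi / N * l))
           - 2 * ln (tan (pi / N * (L - 1 / 2) / 2))"
proof -
  define d where "d = pi / N"
  have d: "d > 0" "d * N = pi" using assms by (auto simp: d_def)
  let ?g = "\<lambda>l::nat. ln (tan (d * (l - 1 / 2) / 2))"
  have "(\<Sum>l=L..N - L. d / sin (d * l)) \<le> (\<Sum>l=L..N - L. ?g (Suc l) - ?g l)"
  proof (rule sum_mono)
    fix l assume l: "l \<in> {L..N - L}"
    have "real l + 1 / 2 < N" using l assms by auto
    then have "d * (real l + 1 / 2) < pi"
      using d by (metis mult_less_cancel_left_pos)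
    moreover have "0 < d * (real l - 1 / 2)" using l assms d by auto
    ultimately have "2 * (d / 2) / sin (d * l) \<le>
        ln (tan ((d * l + d / 2) / 2)) - ln (tan ((d * l - d / 2) / 2))"
      using d by (intro csc_midpoint_integral) (auto simp: algebra_simps)
    then show "d / sin (d * l) \<le> ?g (Suc l) - ?g l"
      by (simp add: algebra_simps)
  qed
  \<comment> \<open>The intervals around the nodes tile the range from \<open>L - 1/2\<close> to
    \<open>N - L + 1/2\<close>. It is symmetric about \<open>N / 2\<close>, so the two boundary
    values of the primitive are opposite.\<close>
  also have "\<dots> = ?g (Suc (N - L)) - ?g L"
    using assms by (intro sum_Suc_diff) auto
  also have "?g (Suc (N - L)) = ln (tan ((pi - d * (real L - 1 / 2)) / 2))"
    using assms d by (simp add: of_nat_diff algebra_simps)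
  also have "\<dots> = - ?g L"
  proof (rule ln_tan_half_pi_minus)
    show "0 < d * (real L - 1 / 2)" using d assms by auto
    have "real L - 1 / 2 < N" using assms by auto
    then show "d * (real L - 1 / 2) < pi" using d by (metis mult_less_cancel_left_pos)
  qed
  finally show ?thesis
    unfolding csc_sum_split[OF assms] d_def
    by (simp add: sum_distrib_left sum_divide_distrib algebra_simps)
qed

lemma csc_sum_lower:
  fixes L N :: nat
  assumes "1 \<le> L" "2 * L \<le> N"
  shows "2 * (\<Sum>l=1..L - 1. pi / N / sin (pi / N * l)) + pi / N / sin (pi / N * L)
           - 2 * ln (tan (pi / N * L / 2)) \<le> pi / N * csc_sum N"
proof -
  define d where "d = pi / N"
  have d: "d > 0" "d * N = pi" using assms by (auto simp: d_def)
  let ?g = "\<lambda>l::nat. ln (tan (d * l / 2))"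
  let ?s = "\<lambda>l::nat. d / 2 / sin (d * l)"
  have "?g (N - L) - ?g L = (\<Sum>l=L..<N - L. ?g (Suc l) - ?g l)"
    using assms by (subst sum_Suc_diff') auto
  also have "\<dots> \<le> (\<Sum>l=L..<N - L. ?s (Suc l) + ?s l)"
  proof (rule sum_mono)
    fix l assume l: "l \<in> {L..<N - L}"
    have "real l + 1 < N" using l assms by auto
    then have "d * (real l + 1) < pi"
      using d by (metis mult_less_cancel_left_pos)
    moreover have "0 < d * l" using l assms d by auto
    ultimately show "?g (Suc l) - ?g l \<le> ?s (Suc l) + ?s l"
      using d csc_trapezoid_integral[of "d / 2" "d * (l + 1 / 2)"]
      by (auto simp: algebra_simps)
  qed
  also have "\<dots> = (\<Sum>l=L..<N - L. ?s (Suc l)) + (\<Sum>l=L..<N - L. ?s l)"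
    by (simp add: sum.distrib)
  \<comment> \<open>Each of the two sums misses one end node. The end nodes thus have half weight,
    and this produces the extra term at \<open>L\<close> in the bound.\<close>
  also have "(\<Sum>l=L..<N - L. ?s (Suc l)) = (\<Sum>l=L..N - L. ?s l) - ?s L"
  proof -
    have "(\<Sum>l=L..<N - L. ?s (Suc l)) = (\<Sum>l=Suc L..N - L. ?s l)"
      by (rule sum.reindex_bij_witness[of _ "\<lambda>l. l - 1" Suc]) auto
    also have "\<dots> = (\<Sum>l=L..N - L. ?s l) - ?s L"
      using assms by (subst (2) sum.atLeast_Suc_atMost) auto
    finally show ?thesis .
  qed
  also have "(\<Sum>l=L..<N - L. ?s l) = (\<Sum>l=L..N - L. ?s l) - ?s (N - L)"
    using assms by (subst sum.last_plus) auto
  also have "?s (N - L) = ?s L"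
  proof -
    have "d * real (N - L) = pi - d * L" using assms d by (simp add: of_nat_diff algebra_simps)
    then show ?thesis by simp
  qed
  finally have "?g (N - L) - ?g L \<le> 2 * (\<Sum>l=L..N - L. ?s l) - 2 * ?s L" by simp
  moreover have "2 * (\<Sum>l=L..N - L. ?s l) = (\<Sum>l=L..N - L. d / sin (d * l))"
    by (simp add: sum_distrib_left)
  moreover have "?g (N - L) = ln (tan ((pi - d * real L) / 2))"
    using assms d by (simp add: of_nat_diff algebra_simps)
  moreover have "\<dots> = - ?g L"
  proof (rule ln_tan_half_pi_minus)
    show "0 < d * real L" using d assms by auto
    have "real L < N" using assms by auto
    then show "d * real L < pi" using d by (metis mult_less_cancel_left_pos)
  qed
  ultimately show ?thesis
    unfolding csc_sum_split[OF assms] d_def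
    by (simp add: sum_distrib_left sum_divide_distrib algebra_simps)
qed

text \<open>The even indices of the larger sum form \<open>csc_sum n\<close>. By convexity each even
  term is at most the mean of its two odd neighbours. The first and last odd terms are then counted
  only once, not twice, which makes the inequality strict.\<close>

lemma csc_sum_double:
  assumes "n \<ge> 2"
  shows "2 * csc_sum n < csc_sum (2 * n)"
proof -
  let ?f = "\<lambda>l::nat. 1 / sin (pi * real l / real (2 * n))"
  have bd: "pi * real l / real (2 * n) < pi" if "l < 2 * n" for l
    using that by (simp add: field_simps)
  have "csc_sum (2 * n) = sum ?f {1..2 * n - 1}" by (simp add: csc_sum_def)
  also have "{1..2 * n - 1} = (\<lambda>l. 2 * l) ` {1..n - 1} \<union> (\<lambda>l. 2 * l - 1) ` {1..n}"
  proof (intro equalityI subsetI)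
    fix l assume "l \<in> {1..2 * n - 1}"
    then show "l \<in> (\<lambda>l. 2 * l) ` {1..n - 1} \<union> (\<lambda>l. 2 * l - 1) ` {1..n}"
      by (cases "even l") (auto elim!: evenE oddE simp: image_iff intro: bexI[of _ "Suc _"])
  qed auto
  also have "sum ?f \<dots> = sum ?f ((\<lambda>l. 2 * l) ` {1..n - 1}) + sum ?f ((\<lambda>l. 2 * l - 1) ` {1..n})"
    by (intro sum.union_disjoint) (auto, presburger)
  also have "sum ?f ((\<lambda>l. 2 * l) ` {1..n - 1}) = csc_sum n"
    unfolding csc_sum_def by (subst sum.reindex) (auto intro: inj_onI)
  also have "sum ?f ((\<lambda>l. 2 * l - 1) ` {1..n}) = (\<Sum>l=1..n. ?f (2 * l - 1))"
    by (subst sum.reindex) (auto intro: inj_onI)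
  finally have eq: "csc_sum (2 * n) = csc_sum n + (\<Sum>l=1..n. ?f (2 * l - 1))" .
  have "2 * csc_sum n = (\<Sum>l=1..n - 1. 2 * ?f (2 * l))"
    unfolding csc_sum_def by (simp add: sum_distrib_left)
  also have "\<dots> \<le> (\<Sum>l=1..n - 1. ?f (2 * l + 1) + ?f (2 * l - 1))"
  proof (rule sum_mono)
    fix l assume l: "l \<in> {1..n - 1}"
    let ?d = "pi / (2 * n)"
    have d: "?d > 0" using assms by simp
    have "2 / sin (?d * (2 * real l)) \<le> 1 / sin (?d * (2 * real l) + ?d) + 1 / sin (?d * (2 * real l) - ?d)"
    proof (rule csc_midpoint)
      have "?d * (2 * real l) - ?d = ?d * (2 * real l - 1)" using assms by (simp add: field_simps)
      also have "\<dots> > 0" using l d by (intro mult_pos_pos) auto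
      finally show "0 < ?d * (2 * real l) - ?d" .
      have "?d * (2 * real l) + ?d = pi * real (2 * l + 1) / real (2 * n)" using assms by (simp add: field_simps)
      also have "\<dots> < pi" using l by (intro bd) auto
      finally show "?d * (2 * real l) + ?d < pi" .
    qed (use d in auto)
    moreover have "pi * real (2 * l - 1) / real (2 * n) = ?d * (2 * real l) - ?d"
    proof -
      have "real (2 * l - 1) = 2 * real l - 1" using l by (subst of_nat_diff) auto
      then show ?thesis using assms by (simp add: field_simps)
    qed
    moreover have "pi * real (2 * l + 1) / real (2 * n) = ?d * (2 * real l) + ?d"
      using assms by (simp add: field_simps)
    moreover have "pi * real (2 * l) / real (2 * n) = ?d * (2 * real l)"
      by simp
    ultimately show "2 * ?f (2 * l) \<le> ?f (2 * l + 1) + ?f (2 * l - 1)"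
      by (simp only:)
  qed
  also have "\<dots> = (\<Sum>l=1..n - 1. ?f (2 * l + 1)) + (\<Sum>l=1..n - 1. ?f (2 * l - 1))"
    by (simp add: sum.distrib)
  also have "(\<Sum>l=1..n - 1. ?f (2 * l + 1)) = (\<Sum>l=Suc 1..n. ?f (2 * l - 1))"
    by (rule sum.reindex_bij_witness[of _ "\<lambda>l. l - 1" Suc]) (use assms in auto)
  also have "\<dots> = (\<Sum>l=1..n. ?f (2 * l - 1)) - ?f 1"
    using assms by (subst (2) sum.atLeast_Suc_atMost) auto
  also have "(\<Sum>l=1..n - 1. ?f (2 * l - 1)) = (\<Sum>l=1..n. ?f (2 * l - 1)) - ?f (2 * n - 1)"
    using assms by (cases n) auto
  finally have le: "2 * csc_sum n \<le> 2 * (\<Sum>l=1..n. ?f (2 * l - 1)) - ?f 1 - ?f (2 * n - 1)" by simp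
  have "?f 1 > 0" "?f (2 * n - 1) > 0"
    using assms bd[of 1] bd[of "2 * n - 1"] by (auto intro!: sin_gt_zero divide_pos_pos)
  with le eq show ?thesis by linarith
qed

section \<open>Elementary estimates, and the comparison of the cosecant sum with
  \<open>4N\<close>\<close>

lemma sin_ge_cubic:
  fixes x :: real
  assumes "x \<ge> 0"
  shows "sin x \<ge> x - x ^ 3 / 6"
proof -
  have "\<bar>sin x - x\<bar> \<le> x ^ 3 / 6"
    using Maclaurin_sin_bound[of x 3] assms
    by (simp add: numeral_3_eq_3 sin_coeff_def fact_numeral field_simps)
  then show ?thesis by linarith
qed

lemma cos_ge_quadratic: "cos x \<ge> 1 - x\<^sup>2 / 2" for x :: real
proof -
  have "(sin (x / 2))\<^sup>2 \<le> (x / 2)\<^sup>2"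
    using abs_sin_x_le_abs_x[of "x / 2"] by (simp only: abs_le_square_iff)
  then show ?thesis
    using cos_double_sin[of "x / 2"] by (simp add: power_divide)
qed

text \<open>Since \<open>tan' = 1 + tan\<^sup>2\<close>, integrating once gives
  \<open>tan t >= t\<close>; inserting this and integrating again gives the cubic term.\<close>

lemma tan_ge_cubic:
  fixes x :: real
  assumes "0 \<le> x" "x < pi / 2"
  shows "tan x \<ge> x + x ^ 3 / 3"
proof -
  have cos: "cos t > 0" if "0 \<le> t" "t \<le> x" for t
    using that assms by (intro cos_gt_zero_pi) auto
  have ge: "tan t \<ge> t" if "0 \<le> t" "t \<le> x" for t
  proof -
    have "tan 0 - 0 \<le> tan t - t"
    proof (rule DERIV_nonneg_imp_nondecreasing[OF that(1), of "\<lambda>t. tan t - t"])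
      fix s assume s: "0 \<le> s" "s \<le> t"
      have "((\<lambda>t. tan t - t) has_real_derivative (tan s)\<^sup>2) (at s)"
        using cos[of s] s that
        by (auto intro!: derivative_eq_intros simp: tan_sec[symmetric] simp flip: power_inverse)
      then show "\<exists>y. ((\<lambda>t. tan t - t) has_real_derivative y) (at s) \<and> 0 \<le> y" by force
    qed
    then show ?thesis by simp
  qed
  have "tan 0 - (0 + 0 ^ 3 / 3) \<le> tan x - (x + x ^ 3 / 3)"
  proof (rule DERIV_nonneg_imp_nondecreasing[OF assms(1), of "\<lambda>t. tan t - (t + t ^ 3 / 3)"])
    fix s assume s: "0 \<le> s" "s \<le> x"
    have "((\<lambda>t. tan t - (t + t ^ 3 / 3)) has_real_derivative (tan s)\<^sup>2 - s\<^sup>2) (at s)"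
      using cos[of s] s
      by (auto intro!: derivative_eq_intros simp: tan_sec[symmetric] simp flip: power_inverse)
    moreover have "s\<^sup>2 \<le> (tan s)\<^sup>2"
      using ge[OF s] s by (intro power_mono) auto
    ultimately show "\<exists>y. ((\<lambda>t. tan t - (t + t ^ 3 / 3)) has_real_derivative y) (at s) \<and> 0 \<le> y"
      by force
  qed
  then show ?thesis by simp
qed

lemma pi_bounds: "3.14159265 \<le> pi" "pi \<le> 3.14159266"
  using pi_approx by simp_all

text \<open>The number \<open>15.41\<close> is \<open>472 / (9.75 pi)\<close> rounded up, the
  reciprocal of the tangent argument used for \<open>N = 472\<close>. Dividing it into
  \<open>16\<close> leaves a quotient near \<open>1\<close>, where two terms of the series
  suffice.\<close>

lemma ln_1541_upper: "ln (15.41 :: real) \<le> 2.73504"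
proof -
  have "ln (15.41 :: real) = 4 * ln 2 - ln (1600 / 1541)"
    using ln_realpow[of 2 4] ln_div[of "16::real" "1600 / 1541"] by simp
  moreover have "ln (2::real) \<le> 0.693149"
    using ln_approx_bounds[of 2 6] by (simp add: eval_nat_numeral)
  moreover have "ln (1600 / 1541 :: real) \<ge> 0.03757"
    using ln_approx_bounds[of "1600 / 1541" 2] by (simp add: eval_nat_numeral)
  ultimately show ?thesis by simp
qed

text \<open>The number \<open>27.374\<close> is \<open>473 / (5.5 pi)\<close> rounded down, the
  analogous reciprocal for \<open>N = 473\<close>.\<close>

lemma ln_27374_lower: "ln (27.374 :: real) \<ge> 3.30955"
proof -
  have "ln (27.374 :: real) = 3 * ln 3 + ln (13687 / 13500)"
    using ln_realpow[of 3 3] ln_mult[of "27::real" "13687 / 13500"] by simp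
  moreover have "ln (3::real) \<ge> 1.098605"
    using ln_approx_bounds[of 3 7] by (simp add: eval_nat_numeral)
  moreover have "ln (13687 / 13500 :: real) \<ge> 0.01375"
    using ln_approx_bounds[of "13687 / 13500" 2] by (simp add: eval_nat_numeral)
  ultimately show ?thesis by simp
qed

text \<open>Here the midpoint rule alone, \<open>L = 1\<close>, is enough: since
  \<open>4 * 400 / pi < 2^9\<close>, it gives a bound \<open>18 ln 2 <= 12.5 < 4 pi\<close>.\<close>

lemma csc_sum_less_small:
  assumes "2 \<le> N" "N \<le> 400"
  shows "csc_sum N < 4 * N"
proof -
  have "pi / N * csc_sum N \<le> 2 * - ln (tan (pi / N * (1 / 2) / 2))"
    using csc_sum_upper[of 1 N] assms by simp
  moreover have "ln (tan (pi / N * (1 / 2) / 2)) \<ge> ln (pi / (4 * N))"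
  proof -
    have "pi / N * (1 / 2) / 2 < pi / 2" using assms by (auto simp: field_simps)
    then have "tan (pi / N * (1 / 2) / 2) \<ge> pi / N * (1 / 2) / 2 + (pi / N * (1 / 2) / 2) ^ 3 / 3"
      by (intro tan_ge_cubic) auto
    then have "tan (pi / N * (1 / 2) / 2) \<ge> pi / (4 * N)"
      by (rule order_trans[rotated]) simp
    then show ?thesis using assms by (intro ln_mono) auto
  qed
  moreover have "ln (pi / (4 * N)) \<ge> ln (1 / 2 ^ 9)"
    using assms pi_bounds by (intro ln_mono) (auto simp: field_simps)
  moreover have "ln (1 / 2 ^ 9 :: real) = - 9 * ln 2"
    using ln_realpow[of 2 9] by (simp add: ln_div)
  ultimately have "pi / N * csc_sum N < 4 * pi"
    using ln2_le_25_over_36 pi_bounds by simp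
  then show ?thesis using assms by (simp add: field_simps)
qed

text \<open>
  At \<open>N = 472\<close> the margin is only \<open>6\<cdot>10\<^sup>-\<^sup>4\<close> out of \<open>2\<pi>\<close>, so the cubic corrections of \<open>sin\<close> and \<open>tan\<close> have
  to be kept: they cancel to first order.
\<close>

lemma csc_sum_less_large:
  assumes "401 \<le> N" "N \<le> 472"
  shows "csc_sum N < 4 * N"
proof -
  define d where "d = pi / N"
  have d: "d > 0" using assms by (simp add: d_def)
  \<comment> \<open>The value of \<open>pi / 401\<close>, rounded up.\<close>
  have d_le: "d \<le> 0.00784" using assms pi_bounds by (simp add: d_def field_simps)
  have "(\<Sum>l=1..19. d / sin (d * real l)) \<le> (\<Sum>l=1..19. 1 / l + 0.169 * d\<^sup>2 * real l)"
  proof (rule sum_mono)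
    fix l :: nat assume l: "l \<in> {1..19}"
    define x where "x = d * l"
    have x: "x > 0" using l d by (simp add: x_def)
    have "x \<le> 0.00784 * 19" unfolding x_def using l d d_le by (intro mult_mono) auto
    then have "x\<^sup>2 \<le> 0.15\<^sup>2" using x by (intro power_mono) auto
    then have x2: "x\<^sup>2 \<le> 0.0225" by (simp add: power2_eq_square)
    \<comment> \<open>The constant \<open>0.169\<close> exceeds \<open>1/6\<close> by just enough to
      absorb the quartic term for \<open>x <= 0.15\<close>.\<close>
    have "1 \<le> (1 - x\<^sup>2 / 6) * (1 + 0.169 * x\<^sup>2)"
    proof -
      have "0 \<le> x\<^sup>2 * (0.169 - 1 / 6 - 0.169 / 6 * x\<^sup>2)" using x2 by (intro mult_nonneg_nonneg) auto
      then show ?thesis by (simp add: algebra_simps)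
    qed
    then have "x * 1 \<le> x * ((1 - x\<^sup>2 / 6) * (1 + 0.169 * x\<^sup>2))" using x by (intro mult_left_mono) auto
    also have "\<dots> = (x - x ^ 3 / 6) * (1 + 0.169 * x\<^sup>2)" by (simp add: algebra_simps power2_eq_square power3_eq_cube)
    also have "\<dots> \<le> sin x * (1 + 0.169 * x\<^sup>2)"
      using sin_ge_cubic[of x] x by (intro mult_right_mono) auto
    finally have "x \<le> sin x * (1 + 0.169 * x\<^sup>2)" by simp
    moreover have "sin x > 0" using x \<open>x \<le> 0.00784 * 19\<close> pi_bounds by (intro sin_gt_zero) auto
    ultimately have "1 / sin x \<le> (1 + 0.169 * x\<^sup>2) / x" using x by (simp add: field_simps)
    then have "d * (1 / sin x) \<le> d * ((1 + 0.169 * x\<^sup>2) / x)" using d by (intro mult_left_mono) auto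
    also have "\<dots> = 1 / l + 0.169 * d\<^sup>2 * real l"
      using d l by (simp add: x_def field_simps power2_eq_square)
    finally show "d / sin (d * real l) \<le> 1 / l + 0.169 * d\<^sup>2 * real l" by (simp add: x_def)
  qed
  also have "\<dots> = (\<Sum>l=1..19. 1 / real l) + 0.169 * d\<^sup>2 * (\<Sum>l=1..19. real l)"
    by (simp add: sum.distrib sum_distrib_left)
  also have "\<dots> \<le> 3.54774 + 32.11 * d\<^sup>2"
  proof -
    have "(\<Sum>l=1..19. 1 / real l) \<le> 3.54774" by (simp add: eval_nat_numeral)
    moreover have "(\<Sum>l=1..19. real l) = 190" by (simp add: eval_nat_numeral)
    ultimately show ?thesis by simp
  qed
  finally have S: "(\<Sum>l=1..19. d / sin (d * real l)) \<le> 3.54774 + 32.11 * d\<^sup>2" .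

  \<comment> \<open>For \<open>L = 20\<close> the tangent in \<open>csc_sum_upper\<close> has
    argument \<open>19.5 d / 2\<close>. The correction \<open>32.11 d\<^sup>2\<close> from the sines
    is met by \<open>31.62 d\<^sup>2\<close> from the factor \<open>1 + t\<close> of the tangent, so
    only \<open>0.49 d\<^sup>2\<close> is lost.\<close>
  define y where "y = 9.75 * d"
  have y: "y > 0" "y \<le> 0.0765" using d d_le by (auto simp: y_def)
  define t where "t = y\<^sup>2 / 3"
  have t_eq: "t = 31.6875 * d\<^sup>2" by (simp add: t_def y_def power2_eq_square)
  have t: "0 \<le> t" "t \<le> 0.002"
  proof -
    have "y\<^sup>2 \<le> 0.0765\<^sup>2" using y by (intro power_mono) auto
    then show "t \<le> 0.002" by (simp add: t_def power2_eq_square)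
  qed (simp add: t_def)
  have "y * (1 + t) \<le> tan y"
    using tan_ge_cubic[of y] y pi_bounds
    by (simp add: t_def algebra_simps power2_eq_square power3_eq_cube)
  then have "ln (y * (1 + t)) \<le> ln (tan y)"
    using y t by (intro ln_mono) auto
  moreover have "ln (y * (1 + t)) = ln y + ln (1 + t)"
    using y t by (intro ln_mult_pos) auto
  moreover have "ln (1 + t) \<ge> t - t\<^sup>2"
    using t by (intro ln_one_plus_pos_lower_bound) auto
  moreover have "t\<^sup>2 \<le> 0.002 * t"
    unfolding power2_eq_square using t by (intro mult_right_mono) auto
  ultimately have "ln (tan y) \<ge> ln y + 0.998 * t" by simp
  moreover have "31.62 * d\<^sup>2 \<le> 0.998 * t"
    unfolding t_eq by simp
  ultimately have T: "ln (tan y) \<ge> ln y + 31.62 * d\<^sup>2" by linarith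

  have "15.41 * y \<ge> 1"
  proof -
    have "pi / 472 \<le> d" unfolding d_def using assms by (intro divide_left_mono) auto
    then show ?thesis using pi_bounds by (simp add: y_def)
  qed
  then have "0 \<le> ln (15.41 * y)" by simp
  also have "\<dots> = ln 15.41 + ln y" using y by (intro ln_mult_pos) auto
  finally have "ln y \<ge> - 2.73504" using ln_1541_upper by simp
  moreover have "d\<^sup>2 \<le> 0.0001"
  proof -
    have "d\<^sup>2 \<le> 0.00784\<^sup>2" using d d_le by (intro power_mono) auto
    then show ?thesis by (simp add: power2_eq_square)
  qed
  moreover have "d * csc_sum N \<le> 2 * (\<Sum>l=1..19. d / sin (d * real l)) - 2 * ln (tan y)"
    using csc_sum_upper[of 20 N] assms by (simp add: d_def y_def mult.commute)
  ultimately have "d * csc_sum N < 4 * pi"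
    using S T pi_bounds by simp
  then show ?thesis using assms by (simp add: d_def field_simps)
qed

lemma csc_sum_less:
  assumes "2 \<le> N" "N \<le> 472"
  shows "csc_sum N < 4 * N"
  using assms csc_sum_less_small csc_sum_less_large by (cases "N \<le> 400") auto

text \<open>The trapezoidal bound with \<open>L = 11\<close>. Every estimate needs only
  \<open>0 < d <= pi / 473\<close>, so one computation covers all larger \<open>N\<close>. The bound
  \<open>sin x <= x\<close> turns the retained terms into a harmonic sum.\<close>

lemma csc_sum_greater:
  assumes "473 \<le> N"
  shows "csc_sum N > 4 * N"
proof -
  define d where "d = pi / N"
  have d: "d > 0" using assms by (simp add: d_def)
  have d_le: "d \<le> pi / 473" unfolding d_def using assms by (intro divide_left_mono) auto
  have csc_ge: "1 / l \<le> d / sin (d * real l)" if "l \<in> {1..11}" for l :: nat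
  proof -
    have "d * l \<le> pi / 473 * 11" using that d d_le by (intro mult_mono) auto
    then have "sin (d * l) > 0" using that d pi_bounds by (intro sin_gt_zero) auto
    moreover have "sin (d * l) \<le> d * l" using d by (intro sin_x_le_x) auto
    ultimately show ?thesis using that d by (simp add: field_simps)
  qed
  have "(\<Sum>l=1..10. 1 / real l) \<le> (\<Sum>l=1..10. d / sin (d * real l))"
    by (rule sum_mono) (use csc_ge in auto)
  moreover have "(\<Sum>l=1..10. 1 / real l) \<ge> 2.928968"
    by (simp add: eval_nat_numeral)
  ultimately have S: "(\<Sum>l=1..10. d / sin (d * real l)) \<ge> 2.928968" by linarith
  \<comment> \<open>The tangent argument \<open>11 d / 2\<close> of \<open>csc_sum_lower\<close>;
    below, \<open>1 - u\<close> is the quadratic lower bound for \<open>cos y\<close>.\<close>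
  define y where "y = 5.5 * d"
  have y: "y > 0" "y \<le> 0.03654" using d d_le pi_bounds by (auto simp: y_def)
  define u where "u = y\<^sup>2 / 2"
  have u: "0 \<le> u" "u \<le> 0.0006676"
  proof -
    have "y\<^sup>2 \<le> 0.03654\<^sup>2" using y by (intro power_mono) auto
    then show "u \<le> 0.0006676" by (simp add: u_def power2_eq_square)
  qed (simp add: u_def)
  have "tan y \<le> y / (1 - u)"
    unfolding tan_def u_def using cos_ge_quadratic[of y] sin_x_le_x[of y] y u
    by (intro frac_le) (auto simp: u_def)
  moreover have "tan y > 0" using y pi_bounds by (intro tan_gt_zero) auto
  ultimately have "ln (tan y) \<le> ln (y / (1 - u))"
    by (intro ln_mono) auto
  also have "\<dots> = ln y - ln (1 - u)"
    using y u by (intro ln_divide_pos) auto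
  finally have "ln (tan y) \<le> ln y - ln (1 - u)" .
  moreover have "ln (1 - u) \<ge> - u - 2 * u\<^sup>2"
    using u by (intro ln_one_minus_pos_lower_bound) auto
  moreover have "u\<^sup>2 \<le> 0.001\<^sup>2" using u by (intro power_mono) auto
  ultimately have T: "ln (tan y) \<le> ln y + 0.00067" using u by (simp add: power_divide)
  have "27.374 * y \<le> 1"
    using d_le pi_bounds by (simp add: y_def)
  then have "0 \<ge> ln (27.374 * y)" using y by simp
  moreover have "ln (27.374 * y) = ln 27.374 + ln y" using y by (intro ln_mult_pos) auto
  ultimately have "ln y \<le> - 3.30955" using ln_27374_lower by simp
  moreover have "2 * (\<Sum>l=1..10. d / sin (d * real l)) + d / sin (d * 11) - 2 * ln (tan y) \<le> d * csc_sum N"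
    using csc_sum_lower[of 11 N] assms by (simp add: d_def y_def mult.commute)
  moreover have "d / sin (d * 11) \<ge> 1 / 11" using csc_ge[of 11] by simp
  ultimately have "d * csc_sum N > 4 * pi"
    using S T pi_bounds by simp
  then show ?thesis using assms by (simp add: d_def field_simps)
qed

section \<open>Forces of regular polygons\<close>

text \<open>The inverse-square field. Division by zero makes it vanish at \<open>0\<close>, so a sum
  over all bodies may include the body itself.\<close>

definition grav :: "complex \<Rightarrow> complex" where
  "grav x = x / of_real (cmod x ^ 3)"

lemma grav_0 [simp]: "grav 0 = 0"
  by (simp add: grav_def)

lemma grav_mult_unit: "cmod v = 1 \<Longrightarrow> grav (v * x) = v * grav x"
  by (simp add: grav_def norm_mult)

lemma grav_scale: "r > 0 \<Longrightarrow> grav (of_real r * x) = grav x / of_real (r\<^sup>2)"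
  by (simp add: grav_def norm_mult power_mult_distrib power2_eq_square power3_eq_cube)

lemma cnj_grav: "cnj (grav x) = grav (cnj x)"
  by (simp add: grav_def)

lemma grav_minus: "grav (- x) = - grav x"
  by (simp add: grav_def)

section \<open>Power series for force sums over roots of unity\<close>

lemma one_minus_powr_sums:
  fixes w :: complex and a :: real
  assumes "cmod w < 1"
  shows "(\<lambda>k. of_real (pochhammer a k / fact k) * w ^ k) sums (1 - w) powr (- of_real a)"
proof -
  \<comment> \<open>Rising factorials show that the coefficients are positive for
    \<open>a > 0\<close>; the signs of the binomial series cancel.\<close>
  have "((- of_real a) gchoose k) * (- w) ^ k = of_real (pochhammer a k / fact k) * w ^ k" for k
  proof -
    have "((- of_real a :: complex) gchoose k) = (- 1) ^ k * of_real (pochhammer a k / fact k)"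
      by (simp add: gbinomial_pochhammer pochhammer_of_real[symmetric])
    then have "((- of_real a) gchoose k) * (- w) ^ k = ((- 1) * (- 1)) ^ k * (of_real (pochhammer a k / fact k) * w ^ k)"
      by (simp only: power_minus[of w] power_mult_distrib mult_ac)
    then show ?thesis by simp
  qed
  then show ?thesis
    using gen_binomial_complex[of "- w" "- of_real a"] assms by simp
qed

text \<open>The norms are the terms of the same series at \<open>cmod w\<close>. Absolute
  convergence is what the Cauchy product requires.\<close>

lemma one_minus_powr_summable:
  fixes w :: complex and a :: real
  assumes "cmod w < 1" "a > 0"
  shows "summable (\<lambda>k. norm (of_real (pochhammer a k / fact k) * w ^ k))"
proof -
  have "(\<lambda>k. of_real (pochhammer a k / fact k) * (of_real (cmod w) :: complex) ^ k)
      sums (1 - of_real (cmod w)) powr (- of_real a)"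
    using assms by (intro one_minus_powr_sums) simp
  then have "summable (\<lambda>k. complex_of_real (pochhammer a k / fact k * cmod w ^ k))"
    by (simp add: sums_iff)
  then have "summable (\<lambda>k. pochhammer a k / fact k * cmod w ^ k)"
    by (simp only: summable_complex_of_real)
  moreover have "norm (of_real (pochhammer a k / fact k) * w ^ k) = pochhammer a k / fact k * cmod w ^ k" for k
    using pochhammer_pos[of a k] assms by (simp add: norm_mult norm_power norm_divide)
  ultimately show ?thesis by simp
qed

text \<open>For \<open>v = 1 - w\<close> the real part is positive, so the principal power commutes
  with conjugation. Hence the powers \<open>-1/2\<close> of \<open>v\<close> and
  \<open>cnj v\<close> multiply to \<open>1 / cmod v\<close>, and dividing by \<open>cnj v\<close>
  gives the field.\<close>

lemma grav_one_minus_eq_powr: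
  assumes "cmod w < 1"
  shows "grav (1 - w) = (1 - w) powr (- of_real (1 / 2)) * (1 - cnj w) powr (- of_real (3 / 2))"
proof -
  define v where "v = 1 - w"
  define u where "u = v powr (- of_real (1 / 2))"
  have "Re w < 1" using complex_Re_le_cmod[of w] assms by linarith
  then have Re: "Re v > 0" by (simp add: v_def)
  then have v: "v \<noteq> 0" "v \<notin> \<real>\<^sub>\<le>\<^sub>0" by (auto simp: complex_nonpos_Reals_iff)
  have "cnj v powr (- of_real (3 / 2)) = cnj v powr (- of_real (1 / 2)) * cnj v powr (- 1)"
    using powr_add[of "cnj v" "- of_real (1 / 2)" "- 1"] by simp
  also have "cnj v powr (- of_real (1 / 2)) = cnj u"
    unfolding u_def using Re by (subst cnj_powr) auto
  also have "cnj v powr (- 1) = inverse (cnj v)"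
    using v by (simp add: powr_minus)
  finally have "u * cnj v powr (- of_real (3 / 2)) = (u * cnj u) / cnj v"
    by (simp add: field_simps)
  also have "u * cnj u = of_real (cmod u ^ 2)"
    by (simp only: complex_norm_square)
  also have "cmod u = cmod v powr (- 1 / 2)"
    unfolding u_def by (subst norm_powr_real_powr') (auto simp: )
  also have "(cmod v powr (- 1 / 2)) ^ 2 = inverse (cmod v)"
    using v by (simp add: powr_minus powr_half_sqrt power_inverse)
  also have "of_real (inverse (cmod v)) / cnj v = v / of_real (cmod v ^ 3)"
  proof -
    have "v * cnj v = of_real (cmod v) * of_real (cmod v)"
      using complex_norm_square[of v] by (simp add: power2_eq_square)
    then show ?thesis using v by (simp add: field_simps power3_eq_cube)
  qed
  finally show ?thesis by (simp add: grav_def u_def v_def)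
qed

text \<open>A closed form for the power sum in \<open>sum_root_moment\<close>, chosen so that its
  nonnegativity is immediate.\<close>

definition root_moment :: "nat \<Rightarrow> nat \<Rightarrow> nat \<Rightarrow> real" where
  "root_moment N p q = (if \<forall>z::complex. z ^ N = 1 \<longrightarrow> z ^ p * cnj z ^ q = 1 then real N else 0)"

lemma root_moment_nonneg: "root_moment N p q \<ge> 0"
  by (simp add: root_moment_def)

lemma cmod_root_unity:
  fixes z :: complex
  assumes "N > 0" "z ^ N = 1"
  shows "cmod z = 1"
  using assms by (metis norm_ge_zero norm_one norm_power power_eq_1_iff order_less_irrefl)

lemma root_moment_diag:
  assumes "N > 0"
  shows "root_moment N p p = N"
proof -
  have "z ^ p * cnj z ^ p = 1" if "z ^ N = 1" for z
    using cmod_root_unity[OF assms that] complex_norm_square[of z]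
    by (simp flip: power_mult_distrib)
  then show ?thesis by (simp add: root_moment_def)
qed

text \<open>Orthogonality of characters: if the summand is not constantly \<open>1\<close>,
  multiplying the roots by a suitable \<open>v\<close> permutes them but scales the sum by a factor
  other than \<open>1\<close>.\<close>

lemma sum_root_moment:
  assumes "N > 0"
  shows "(\<Sum>z | z ^ N = 1. z ^ p * cnj z ^ q) = of_real (root_moment N p q)"
proof (cases "\<forall>z::complex. z ^ N = 1 \<longrightarrow> z ^ p * cnj z ^ q = 1")
  case True
  then show ?thesis using card_roots_unity_eq[OF assms] by (simp add: root_moment_def)
next
  case False
  then obtain v :: complex where v: "v ^ N = 1" "v ^ p * cnj v ^ q \<noteq> 1" by blast
  have "v \<noteq> 0" using v assms by (auto simp: power_0_left)
  let ?S = "\<Sum>z | z ^ N = 1. z ^ p * cnj z ^ q"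
  have "?S = (\<Sum>z | z ^ N = 1. (v * z) ^ p * cnj (v * z) ^ q)"
    by (rule sum.reindex_bij_witness[of _ "\<lambda>z. v * z" "\<lambda>z. z / v"])
       (use v \<open>v \<noteq> 0\<close> in \<open>auto simp: power_mult_distrib power_divide\<close>)
  also have "\<dots> = v ^ p * cnj v ^ q * ?S"
    by (simp add: sum_distrib_left power_mult_distrib mult_ac)
  finally have "(v ^ p * cnj v ^ q - 1) * ?S = 0" by (simp add: algebra_simps)
  then have "?S = 0" using v by simp
  then show ?thesis using False by (simp only: root_moment_def if_False of_real_0)
qed

text \<open>
  With \<open>N = 2n\<close>, the weight \<open>z\<^sup>p\<close> is \<open>1\<close> for \<open>p = 0\<close> and the sign that separates \<open>z\<^sup>n = 1\<close> from \<open>z\<^sup>n = -1\<close>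
  for \<open>p = n\<close>; the inversion \<open>x \<mapsto> 1/x\<close> raises \<open>p\<close> by one.
\<close>

definition root_force :: "nat \<Rightarrow> nat \<Rightarrow> real \<Rightarrow> complex" where
  "root_force N p x = (\<Sum>z | z ^ N = 1. z ^ p * grav (1 - of_real x * cnj z))"

definition root_force_coeff :: "nat \<Rightarrow> nat \<Rightarrow> nat \<Rightarrow> real" where
  "root_force_coeff N p k = (\<Sum>i\<le>k. pochhammer (1 / 2) i / fact i *
      (pochhammer (3 / 2) (k - i) / fact (k - i)) * root_moment N (p + (k - i)) i)"

text \<open>With \<open>w = x cnj z\<close> the two binomial factors are series in
  \<open>x cnj z\<close> and \<open>x z\<close>. Their Cauchy product is summed over the roots,
  which turns each monomial into a moment.\<close>

lemma root_force_sums: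
  assumes "N > 0" "0 \<le> x" "x < 1"
  shows "(\<lambda>k. of_real (root_force_coeff N p k * x ^ k)) sums root_force N p x"
proof -
  define a b :: "nat \<Rightarrow> real" where "a = (\<lambda>i. pochhammer (1 / 2) i / fact i)"
    and "b = (\<lambda>i. pochhammer (3 / 2) i / fact i)"
  have 1: "(\<lambda>k. z ^ p * (\<Sum>i\<le>k. (of_real (a i) * (of_real x * cnj z) ^ i) *
      (of_real (b (k - i)) * (of_real x * z) ^ (k - i)))) sums (z ^ p * grav (1 - of_real x * cnj z))"
    if "z ^ N = 1" for z
  proof -
    have w: "cmod (of_real x * cnj z) < 1" "cmod (of_real x * z) < 1"
      using cmod_root_unity[OF assms(1) that] assms by (auto simp: norm_mult)
    have "(\<lambda>k. \<Sum>i\<le>k. (of_real (a i) * (of_real x * cnj z) ^ i) *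
        (of_real (b (k - i)) * (of_real x * z) ^ (k - i))) sums
        ((\<Sum>i. of_real (a i) * (of_real x * cnj z) ^ i) * (\<Sum>i. of_real (b i) * (of_real x * z) ^ i))"
      unfolding a_def b_def using w by (intro Cauchy_product_sums one_minus_powr_summable) auto
    also have "(\<Sum>i. of_real (a i) * (of_real x * cnj z) ^ i) = (1 - of_real x * cnj z) powr (- of_real (1 / 2))"
      unfolding a_def using w by (intro sums_unique[symmetric] one_minus_powr_sums)
    also have "(\<Sum>i. of_real (b i) * (of_real x * z) ^ i) = (1 - of_real x * z) powr (- of_real (3 / 2))"
      unfolding b_def using w by (intro sums_unique[symmetric] one_minus_powr_sums)
    finally show ?thesis
      using grav_one_minus_eq_powr[OF w(1)] by (intro sums_mult) simp
  qed
  have "(\<lambda>k. \<Sum>z | z ^ N = 1. z ^ p * (\<Sum>i\<le>k. (of_real (a i) * (of_real x * cnj z) ^ i) *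
      (of_real (b (k - i)) * (of_real x * z) ^ (k - i)))) sums root_force N p x"
    unfolding root_force_def by (intro sums_sum 1) simp
  moreover have "(\<Sum>z | z ^ N = 1. z ^ p * (\<Sum>i\<le>k. (of_real (a i) * (of_real x * cnj z) ^ i) *
      (of_real (b (k - i)) * (of_real x * z) ^ (k - i)))) = of_real (root_force_coeff N p k * x ^ k)" for k
  proof -
    have "(\<Sum>z | z ^ N = 1. z ^ p * (\<Sum>i\<le>k. (of_real (a i) * (of_real x * cnj z) ^ i) *
        (of_real (b (k - i)) * (of_real x * z) ^ (k - i)))) =
      (\<Sum>z | z ^ N = 1. \<Sum>i\<le>k. of_real (a i * b (k - i) * x ^ k) * (z ^ (p + (k - i)) * cnj z ^ i))"
    proof (intro sum.cong refl, unfold sum_distrib_left, intro sum.cong refl)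
      fix z :: complex and i assume "i \<in> {..k}"
      then have "(of_real x :: complex) ^ k = of_real x ^ i * of_real x ^ (k - i)"
        by (simp flip: power_add)
      then show "z ^ p * ((of_real (a i) * (of_real x * cnj z) ^ i) * (of_real (b (k - i)) * (of_real x * z) ^ (k - i)))
          = of_real (a i * b (k - i) * x ^ k) * (z ^ (p + (k - i)) * cnj z ^ i)"
        by (simp add: power_mult_distrib power_add mult_ac)
    qed
    also have "\<dots> = (\<Sum>i\<le>k. of_real (a i * b (k - i) * x ^ k) * (\<Sum>z | z ^ N = 1. z ^ (p + (k - i)) * cnj z ^ i))"
      by (subst sum.swap) (simp add: sum_distrib_left)
    also have "\<dots> = of_real (root_force_coeff N p k * x ^ k)"
      unfolding sum_root_moment[OF assms(1)] root_force_coeff_def a_def b_def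
      by (simp add: sum_distrib_left sum_distrib_right mult_ac)
    finally show ?thesis .
  qed
  ultimately show ?thesis by simp
qed

lemma root_force_coeff_ge:
  assumes "i \<le> k"
  shows "root_force_coeff N p k \<ge> pochhammer (1 / 2) i / fact i *
      (pochhammer (3 / 2) (k - i) / fact (k - i)) * root_moment N (p + (k - i)) i"
  unfolding root_force_coeff_def using assms
  by (intro member_le_sum[where f = "\<lambda>i. pochhammer (1 / 2) i / fact i *
      (pochhammer (3 / 2) (k - i) / fact (k - i)) * root_moment N (p + (k - i)) i"])
     (auto intro!: mult_nonneg_nonneg divide_nonneg_nonneg root_moment_nonneg less_imp_le[OF pochhammer_pos])

lemma root_force_coeff_nonneg: "root_force_coeff N p k \<ge> 0"
  unfolding root_force_coeff_def
  by (auto intro!: sum_nonneg mult_nonneg_nonneg divide_nonneg_nonneg root_moment_nonneg less_imp_le[OF pochhammer_pos])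

lemma root_force_Re_sums:
  assumes "N > 0" "0 \<le> x" "x < 1"
  shows "(\<lambda>k. root_force_coeff N p k * x ^ k) sums Re (root_force N p x)"
  using sums_Re[OF root_force_sums[OF assms, of p]] by simp

lemma root_force_pos:
  assumes "N > 0" "0 < x" "x < 1"
  shows "Re (root_force N p x) > 0"
proof -
  \<comment> \<open>In the coefficient of \<open>x^p\<close> the term \<open>i = p\<close> carries a
    diagonal moment, which equals \<open>N\<close>.\<close>
  have "0 < pochhammer (1 / 2) p / fact p * (pochhammer (3 / 2) (p - p) / fact (p - p)) * root_moment N (p + (p - p)) p"
    using assms by (simp add: root_moment_diag pochhammer_pos)
  also have "\<dots> \<le> root_force_coeff N p p" by (rule root_force_coeff_ge) simp
  finally have "0 < root_force_coeff N p p * x ^ p" using assms by simp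
  also have "\<dots> \<le> Re (root_force N p x)"
    using root_force_Re_sums[of N x p] assms sum_le_suminf[of "\<lambda>k. root_force_coeff N p k * x ^ k" "{p}"]
    by (auto simp: sums_iff root_force_coeff_nonneg)
  finally show ?thesis .
qed

lemma root_force_0_gt:
  assumes "N > 0" "0 < x" "x < 1"
  shows "Re (root_force N 0 x) > N"
proof -
  \<comment> \<open>The constant term is exactly \<open>N\<close>; strictness comes from the
    diagonal moment in the coefficient of \<open>x\<^sup>2\<close>.\<close>
  have "0 < pochhammer (1 / 2) 1 / fact 1 * (pochhammer (3 / 2) (2 - 1) / fact (2 - 1)) * root_moment N (0 + (2 - 1)) 1"
    using assms by (simp add: root_moment_diag)
  also have "\<dots> \<le> root_force_coeff N 0 2" by (rule root_force_coeff_ge) simp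
  finally have "0 < root_force_coeff N 0 2 * x ^ 2" using assms by simp
  moreover have "root_force_coeff N 0 0 * x ^ 0 = N"
    using assms by (simp add: root_force_coeff_def root_moment_diag)
  moreover have "(\<Sum>k\<in>{0, 2}. root_force_coeff N 0 k * x ^ k) \<le> Re (root_force N 0 x)"
    using root_force_Re_sums[of N x 0] assms sum_le_suminf[of "\<lambda>k. root_force_coeff N 0 k * x ^ k" "{0, 2}"]
    by (auto simp: sums_iff root_force_coeff_nonneg)
  ultimately show ?thesis by simp
qed

section \<open>Attraction of the polygons on a point\<close>

definition gon :: "nat \<Rightarrow> complex \<Rightarrow> complex set" where
  "gon n s = {z. z ^ n = s}"

text \<open>
  Since \<open>grav 0 = 0\<close>, at \<open>s = 1\<close> and \<open>x = 1\<close> the vertex \<open>1\<close> does not attract itself.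
\<close>

definition gon_force :: "nat \<Rightarrow> complex \<Rightarrow> real \<Rightarrow> real" where
  "gon_force n s x = Re (\<Sum>z\<in>gon n s. grav (1 - of_real x * z))"

lemma finite_gon: "n > 0 \<Longrightarrow> finite (gon n s)"
  unfolding gon_def by (rule finite_nth_roots)

lemma cmod_gon:
  assumes "n > 0" "z \<in> gon n s" "s\<^sup>2 = 1"
  shows "cmod z = 1"
proof (rule cmod_root_unity)
  show "z ^ (n * 2) = 1" using assms by (simp add: gon_def power_mult)
qed (use assms in simp)

lemma sum_gon_cnj:
  assumes "s\<^sup>2 = 1"
  shows "(\<Sum>z\<in>gon n s. f (cnj z)) = (\<Sum>z\<in>gon n s. f z)"
proof -
  have "cnj s = s" using assms by (auto simp: power2_eq_1_iff)
  then have "cnj z ^ n = s \<longleftrightarrow> z ^ n = s" for z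
    by (metis complex_cnj_cnj complex_cnj_power)
  then show ?thesis
    by (intro sum.reindex_bij_witness[of _ cnj cnj]) (auto simp: gon_def)
qed

text \<open>The polygon is symmetric under conjugation, so the force on a real point has no
  tangential component.\<close>

lemma sum_gon_grav:
  assumes "s\<^sup>2 = 1"
  shows "(\<Sum>z\<in>gon n s. grav (1 - of_real x * z)) = of_real (gon_force n s x)"
proof -
  have "cnj (\<Sum>z\<in>gon n s. grav (1 - of_real x * z)) = (\<Sum>z\<in>gon n s. grav (1 - of_real x * cnj z))"
    by (simp add: cnj_sum cnj_grav)
  also have "\<dots> = (\<Sum>z\<in>gon n s. grav (1 - of_real x * z))"
    by (rule sum_gon_cnj[OF assms])
  finally have "(\<Sum>z\<in>gon n s. grav (1 - of_real x * z)) \<in> \<real>"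
    by (simp only: Reals_cnj_iff)
  then show ?thesis unfolding gon_force_def by (simp only: of_real_Re)
qed

text \<open>Rotating by \<open>v\<close> moves the vertex to \<open>1\<close> and turns the polygon
  \<open>s\<close> into the polygon \<open>s * t\<close>, because \<open>1 / t = t\<close>.\<close>

lemma sum_gon_grav_vertex:
  assumes "n > 0" "s\<^sup>2 = 1" "t\<^sup>2 = 1" "v \<in> gon n t"
  shows "(\<Sum>z\<in>gon n s. grav (v - of_real x * z)) = v * of_real (gon_force n (s * t) x)"
proof -
  have v: "cmod v = 1" using cmod_gon[OF assms(1,4,3)] .
  then have "v \<noteq> 0" by auto
  have t: "t * t = 1" using assms by (simp add: power2_eq_square)
  then have "t \<noteq> 0" by auto
  have "(\<Sum>z\<in>gon n s. grav (v - of_real x * z)) = (\<Sum>z\<in>gon n (s * t). grav (v - of_real x * (v * z)))"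
    by (rule sum.reindex_bij_witness[of _ "\<lambda>z. v * z" "\<lambda>z. z / v"])
       (use assms t \<open>t \<noteq> 0\<close> \<open>v \<noteq> 0\<close> in \<open>auto simp: gon_def power_mult_distrib power_divide field_simps\<close>)
  also have "\<dots> = (\<Sum>z\<in>gon n (s * t). v * grav (1 - of_real x * z))"
    by (intro sum.cong refl) (simp add: grav_mult_unit[OF v, symmetric] algebra_simps)
  also have "\<dots> = v * of_real (gon_force n (s * t) x)"
    using assms by (simp add: sum_gon_grav power_mult_distrib flip: sum_distrib_left)
  finally show ?thesis .
qed

lemma gon_disjoint: "gon n 1 \<inter> gon n (- 1) = {}"
  by (auto simp: gon_def)

lemma gon_union: "gon n 1 \<union> gon n (- 1) = {z. z ^ (2 * n) = 1}"
  by (auto simp: gon_def power_mult[of _ n 2] mult.commute[of 2 n] power2_eq_1_iff)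

lemma gon_force_add:
  assumes "n > 0"
  shows "gon_force n 1 x + gon_force n (- 1) x = Re (root_force (2 * n) 0 x)"
proof -
  have "gon_force n 1 x + gon_force n (- 1) x = Re ((\<Sum>z\<in>gon n 1. grav (1 - of_real x * cnj z)) +
      (\<Sum>z\<in>gon n (- 1). grav (1 - of_real x * cnj z)))"
    by (simp add: gon_force_def sum_gon_cnj[of _ "\<lambda>z. grav (1 - of_real x * z)"])
  also have "(\<Sum>z\<in>gon n 1. grav (1 - of_real x * cnj z)) + (\<Sum>z\<in>gon n (- 1). grav (1 - of_real x * cnj z))
      = root_force (2 * n) 0 x"
    unfolding root_force_def gon_union[symmetric] using assms finite_gon gon_disjoint
    by (subst sum.union_disjoint) auto
  finally show ?thesis .
qed

lemma gon_force_diff: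
  assumes "n > 0"
  shows "gon_force n 1 x - gon_force n (- 1) x = Re (root_force (2 * n) n x)"
proof -
  have "gon_force n 1 x - gon_force n (- 1) x = Re ((\<Sum>z\<in>gon n 1. grav (1 - of_real x * cnj z)) -
      (\<Sum>z\<in>gon n (- 1). grav (1 - of_real x * cnj z)))"
    by (simp add: gon_force_def sum_gon_cnj[of _ "\<lambda>z. grav (1 - of_real x * z)"])
  also have "(\<Sum>z\<in>gon n 1. grav (1 - of_real x * cnj z)) - (\<Sum>z\<in>gon n (- 1). grav (1 - of_real x * cnj z))
      = (\<Sum>z\<in>gon n 1. z ^ n * grav (1 - of_real x * cnj z)) + (\<Sum>z\<in>gon n (- 1). z ^ n * grav (1 - of_real x * cnj z))"
    by (simp add: gon_def sum_negf)
  also have "\<dots> = root_force (2 * n) n x"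
    unfolding root_force_def gon_union[symmetric] using assms finite_gon gon_disjoint
    by (subst sum.union_disjoint) auto
  finally show ?thesis .
qed

text \<open>On the unit circle \<open>1 - x cnj z = x (- cnj z) (1 - z / x)\<close>. The field pulls
  out the unit factor and the scale; reindexing by conjugation turns the unit factor into one more
  power of \<open>z\<close>. The hypothesis on \<open>p\<close> says that the weight is
  real.\<close>

lemma root_force_inversion:
  assumes "N > 0" "x > 0" and p: "\<And>z. z ^ N = 1 \<Longrightarrow> cnj z ^ p = z ^ p"
  shows "root_force N p x = - root_force N (p + 1) (1 / x) / of_real (x\<^sup>2)"
proof -
  have "root_force N p x = (\<Sum>z | z ^ N = 1. - (z ^ (p + 1) * grav (1 - of_real (1 / x) * cnj z)) / of_real (x\<^sup>2))"
    unfolding root_force_def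
  proof (rule sum.reindex_bij_witness[of _ cnj cnj])
    fix z :: complex assume "z \<in> {z. z ^ N = 1}"
    then have z: "z ^ N = 1" by simp
    then show "cnj z \<in> {z. z ^ N = 1}" by (simp flip: complex_cnj_power)
    have c: "cmod z = 1" using cmod_root_unity[OF assms(1) z] .
    then have zz: "z * cnj z = 1" using complex_norm_square[of z] by simp
    have "1 - of_real x * cnj z = of_real x * ((- cnj z) * (1 - of_real (1 / x) * cnj (cnj z)))"
      using assms zz by (simp add: algebra_simps)
    then have "grav (1 - of_real x * cnj z) = (- cnj z) * grav (1 - of_real (1 / x) * cnj (cnj z)) / of_real (x\<^sup>2)"
      using assms c by (simp only: grav_scale grav_mult_unit norm_minus_cancel complex_mod_cnj)
    then show "- (cnj z ^ (p + 1) * grav (1 - of_real (1 / x) * cnj (cnj z))) / of_real (x\<^sup>2) =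
        z ^ p * grav (1 - of_real x * cnj z)"
      using p[OF z] by simp
  qed (auto simp flip: complex_cnj_power)
  then show ?thesis
    by (simp add: root_force_def sum_negf sum_divide_distrib)
qed

lemma gon_force_add_gt:
  assumes "n > 0" "0 < x" "x < 1"
  shows "gon_force n 1 x + gon_force n (- 1) x > 2 * n"
  using gon_force_add[of n x] root_force_0_gt[of "2 * n" x] assms by simp

lemma gon_force_diff_pos:
  assumes "n > 0" "0 < x" "x < 1"
  shows "gon_force n 1 x > gon_force n (- 1) x"
  using gon_force_diff[of n x] root_force_pos[of "2 * n" x n] assms by simp

text \<open>Inversion leads back to the interval \<open>(0,1)\<close>, at the price of a minus sign
  and the weight \<open>p = 1\<close>, where the series is positive.\<close>

lemma gon_force_add_neg:
  assumes "n > 0" "x > 1"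
  shows "gon_force n 1 x + gon_force n (- 1) x < 0"
  using gon_force_add[of n x] root_force_inversion[of "2 * n" x 0] root_force_pos[of "2 * n" "1 / x" 1] assms
  by (simp add: divide_neg_pos Re_divide_of_real flip: of_real_power)

lemma gon_force_diff_neg:
  assumes "n > 0" "x > 1"
  shows "gon_force n 1 x < gon_force n (- 1) x"
proof -
  have "cnj z ^ n = z ^ n" if "z ^ (2 * n) = 1" for z :: complex
  proof -
    have "(z ^ n)\<^sup>2 = 1" using that by (simp add: mult.commute[of 2] power_mult)
    then have "cnj (z ^ n) = z ^ n" by (auto simp: power2_eq_1_iff simp del: complex_cnj_power)
    then show ?thesis by simp
  qed
  then have "root_force (2 * n) n x = - root_force (2 * n) (n + 1) (1 / x) / of_real (x\<^sup>2)"
    using assms by (intro root_force_inversion) auto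
  then have "gon_force n 1 x - gon_force n (- 1) x = - (Re (root_force (2 * n) (n + 1) (1 / x)) / x\<^sup>2)"
    using gon_force_diff[of n x] assms by (simp add: Re_divide_of_real flip: of_real_power)
  moreover have "Re (root_force (2 * n) (n + 1) (1 / x)) / x\<^sup>2 > 0"
    using root_force_pos[of "2 * n" "1 / x" "n + 1"] assms by simp
  ultimately show ?thesis by linarith
qed

text \<open>The chord has length \<open>2 sin (t/2)\<close> and its real part is
  \<open>2 sin\<^sup>2 (t/2)\<close>.\<close>

lemma Re_grav_one_minus_cis:
  assumes "0 < t" "t < 2 * pi"
  shows "Re (grav (1 - cis t)) = 1 / (4 * sin (t / 2))"
proof -
  have s: "sin (t / 2) > 0" using assms by (intro sin_gt_zero) auto
  have c: "1 - cos t = 2 * (sin (t / 2))\<^sup>2" using cos_double_sin[of "t / 2"] by simp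
  have "(cmod (1 - cis t))\<^sup>2 = (1 - cos t)\<^sup>2 + (sin t)\<^sup>2"
    by (simp add: cmod_power2)
  also have "\<dots> = 2 * (1 - cos t)"
    unfolding sin_squared_eq by (simp add: power2_eq_square algebra_simps)
  also have "\<dots> = (2 * sin (t / 2))\<^sup>2" unfolding c by (simp add: power_mult_distrib)
  finally have "cmod (1 - cis t) = 2 * sin (t / 2)"
    by (rule power2_eq_imp_eq) (use s in auto)
  then have "grav (1 - cis t) = (1 - cis t) / of_real (8 * sin (t / 2) ^ 3)"
    by (simp add: grav_def power_mult_distrib)
  then have "Re (grav (1 - cis t)) = (1 - cos t) / (8 * sin (t / 2) ^ 3)"
    by (simp only: Re_divide_of_real) simp
  then show ?thesis unfolding c using s by (simp add: power2_eq_square power3_eq_cube)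
qed

lemma Re_sum_grav_roots_unity:
  assumes "N > 0"
  shows "Re (\<Sum>z | z ^ N = 1. grav (1 - z)) = csc_sum N / 4"
proof -
  have "(\<Sum>z | z ^ N = 1. grav (1 - z)) = (\<Sum>l<N. grav (1 - cis (2 * pi * real l / real N)))"
    by (rule sum.reindex_bij_betw[symmetric, OF Complex.bij_betw_roots_unity[OF assms]])
  also have "{..<N} = insert 0 {1..N - 1}" using assms by auto
  finally have "Re (\<Sum>z | z ^ N = 1. grav (1 - z)) = (\<Sum>l=1..N - 1. Re (grav (1 - cis (2 * pi * real l / real N))))"
    by simp
  also have "\<dots> = (\<Sum>l=1..N - 1. 1 / (4 * sin (2 * pi * real l / real N / 2)))"
    by (intro sum.cong refl Re_grav_one_minus_cis) (use assms in \<open>auto simp: field_simps\<close>)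
  finally show ?thesis by (simp add: csc_sum_def sum_divide_distrib mult.commute)
qed

lemma gon_force_1_1:
  assumes "n > 0"
  shows "gon_force n 1 1 = csc_sum n / 4"
  using Re_sum_grav_roots_unity[OF assms] by (simp add: gon_force_def gon_def)

lemma gon_force_1_add:
  assumes "n > 0"
  shows "gon_force n 1 1 + gon_force n (- 1) 1 = csc_sum (2 * n) / 4"
proof -
  have "gon_force n 1 1 + gon_force n (- 1) 1 = Re (\<Sum>z\<in>gon n 1 \<union> gon n (- 1). grav (1 - z))"
    using assms gon_disjoint by (subst sum.union_disjoint) (auto simp: gon_force_def finite_gon)
  then show ?thesis
    unfolding gon_union using Re_sum_grav_roots_unity[of "2 * n"] assms by simp
qed

section \<open>Relative equilibria of the configuration\<close>

text \<open>The acceleration of the rotating motion is \<open>- r i * cis t\<close>, and the forces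
  rotate along, so the time factor cancels. Conversely, uniqueness of derivatives fixes the
  existentially quantified \<open>v\<close> and \<open>a\<close>, and time \<open>0\<close>
  suffices.\<close>

lemma is_rel_eq_iff:
  assumes "\<And>i. i < N \<Longrightarrow> mu i > 0"
  shows "is_rel_eq N mu r \<longleftrightarrow> (\<forall>i<N. (\<Sum>j<N. of_real (mu j) * grav (r i - r j)) = r i)"
proof -
  have cis': "((\<lambda>t. z * cis t) has_vector_derivative z * \<i> * cis t) (at t)" for z t
    unfolding cis_conv_exp
    by (rule has_vector_derivative_real_field) (auto intro!: derivative_eq_intros simp: exp_of_real)
  have force: "(\<Sum>j\<in>{..<N} - {i}. of_real (mu i * mu j) * (r j * cis t - r i * cis t)
       / of_real (cmod (r j * cis t - r i * cis t) ^ 3))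
     = - of_real (mu i) * (\<Sum>j<N. of_real (mu j) * grav (r i - r j)) * cis t" if "i < N" for i t
  proof -
    have "(\<Sum>j\<in>{..<N} - {i}. of_real (mu i * mu j) * (r j * cis t - r i * cis t)
       / of_real (cmod (r j * cis t - r i * cis t) ^ 3))
      = (\<Sum>j\<in>{..<N} - {i}. - of_real (mu i) * (of_real (mu j) * grav (r i - r j)) * cis t)"
    proof (intro sum.cong refl)
      fix j
      have "r j * cis t - r i * cis t = - (cis t * (r i - r j))" by (simp add: algebra_simps)
      then have "grav (r j * cis t - r i * cis t) = - (cis t * grav (r i - r j))"
        by (simp only: grav_minus grav_mult_unit norm_cis)
      moreover have "of_real (mu i * mu j) * (r j * cis t - r i * cis t) / of_real (cmod (r j * cis t - r i * cis t) ^ 3)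
          = of_real (mu i * mu j) * grav (r j * cis t - r i * cis t)"
        by (simp add: grav_def)
      ultimately show "of_real (mu i * mu j) * (r j * cis t - r i * cis t) / of_real (cmod (r j * cis t - r i * cis t) ^ 3)
          = - of_real (mu i) * (of_real (mu j) * grav (r i - r j)) * cis t"
        by simp
    qed
    also have "\<dots> = (\<Sum>j<N. - of_real (mu i) * (of_real (mu j) * grav (r i - r j)) * cis t)"
      using that by (intro sum.mono_neutral_left) auto
    finally show ?thesis by (simp only: sum_distrib_left sum_distrib_right)
  qed
  show ?thesis
  proof
    assume "is_rel_eq N mu r"
    then obtain v a where va: "\<And>i t. i < N \<Longrightarrow> ((\<lambda>t. r i * cis t) has_vector_derivative v i t) (at t)"
      "\<And>i t. i < N \<Longrightarrow> (v i has_vector_derivative a i t) (at t)"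
      "\<And>i t. i < N \<Longrightarrow> of_real (mu i) * a i t = (\<Sum>j\<in>{..<N} - {i}. of_real (mu i * mu j) *
          (r j * cis t - r i * cis t) / of_real (cmod (r j * cis t - r i * cis t) ^ 3))"
      unfolding is_rel_eq_def nbody_solution_def by blast
    show "\<forall>i<N. (\<Sum>j<N. of_real (mu j) * grav (r i - r j)) = r i"
    proof (intro allI impI)
      fix i assume i: "i < N"
      have "v i = (\<lambda>t. r i * \<i> * cis t)"
        using vector_derivative_unique_at[OF va(1)[OF i] cis'] by (intro ext)
      then have "a i 0 = r i * \<i> * \<i> * cis 0"
        using vector_derivative_unique_at[OF va(2)[OF i, of 0]] cis'[of "r i * \<i>" 0] by simp
      then have "of_real (mu i) * (\<Sum>j<N. of_real (mu j) * grav (r i - r j)) = of_real (mu i) * r i"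
        using va(3)[OF i, of 0] unfolding force[OF i] by (auto simp: mult.assoc)
      then show "(\<Sum>j<N. of_real (mu j) * grav (r i - r j)) = r i"
        using assms[OF i] by simp
    qed
  next
    assume eq: "\<forall>i<N. (\<Sum>j<N. of_real (mu j) * grav (r i - r j)) = r i"
    show "is_rel_eq N mu r"
      unfolding is_rel_eq_def nbody_solution_def
    proof (intro exI allI impI conjI)
      fix i t assume i: "i < N"
      show "((\<lambda>t. r i * cis t) has_vector_derivative (\<lambda>i t. r i * \<i> * cis t) i t) (at t)"
        using cis' by simp
      show "((\<lambda>i t. r i * \<i> * cis t) i has_vector_derivative (\<lambda>i t. r i * \<i> * \<i> * cis t) i t) (at t)"
        using cis' by simp
      show "of_real (mu i) * (\<lambda>i t. r i * \<i> * \<i> * cis t) i t = (\<Sum>j\<in>{..<N} - {i}. of_real (mu i * mu j) *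
          (r j * cis t - r i * cis t) / of_real (cmod (r j * cis t - r i * cis t) ^ 3))"
        unfolding force[OF i] using eq i by (simp add: mult.assoc[of _ \<i> \<i>])
    qed
  qed
qed

lemma bij_betw_gon_even:
  assumes "n > 0"
  shows "bij_betw (\<lambda>l. cis (2 * pi * real l / real n)) {..<n} (gon n 1)"
  using Complex.bij_betw_roots_unity[OF assms] by (simp add: gon_def)

lemma bij_betw_gon_odd:
  assumes "n > 0"
  shows "bij_betw (\<lambda>l. cis (pi * real (2 * l + 1) / real n)) {..<n} (gon n (- 1))"
proof -
  define \<zeta> where "\<zeta> = cis (pi / n)"
  have \<zeta>: "\<zeta> ^ n = - 1" unfolding \<zeta>_def Complex.DeMoivre using assms by simp
  have "\<zeta> \<noteq> 0" by (simp add: \<zeta>_def)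
  have "bij_betw (\<lambda>z. \<zeta> * z) (gon n 1) (gon n (- 1))"
    by (rule bij_betw_byWitness[where f' = "\<lambda>z. z / \<zeta>"])
       (use \<zeta> \<open>\<zeta> \<noteq> 0\<close> in \<open>auto simp: gon_def power_mult_distrib power_divide\<close>)
  from bij_betw_trans[OF bij_betw_gon_even[OF assms] this] show ?thesis
    by (rule bij_betw_cong[THEN iffD1, rotated])
       (simp add: \<zeta>_def cis_mult add_divide_distrib distrib_left mult_ac)
qed

lemma cfg_index_decomp:
  "{..<1 + 3 * n} = insert 0 (Suc ` {..<n} \<union> ((\<lambda>l. n + 1 + 2 * l) ` {..<n} \<union> (\<lambda>l. n + 2 + 2 * l) ` {..<n}))"
proof (intro equalityI subsetI)
  fix i assume i: "i \<in> {..<1 + 3 * n}"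
  consider "i = 0" | "0 < i" "i \<le> n" | "i > n" "even (i - n - 1)" | "i > n" "odd (i - n - 1)" by linarith
  then show "i \<in> insert 0 (Suc ` {..<n} \<union> ((\<lambda>l. n + 1 + 2 * l) ` {..<n} \<union> (\<lambda>l. n + 2 + 2 * l) ` {..<n}))"
  proof cases
    case 2
    then have "i = Suc (i - 1)" "i - 1 < n" by auto
    then show ?thesis by blast
  next
    case 3
    from 3(2) obtain l where "i - n - 1 = 2 * l" by (rule evenE)
    then have "i = n + 1 + 2 * l" "l < n" using 3 i by auto
    then show ?thesis by blast
  next
    case 4
    from 4(2) obtain l where "i - n - 1 = 2 * l + 1" by (rule oddE)
    then have "i = n + 2 + 2 * l" "l < n" using 4 i by auto
    then show ?thesis by blast
  qed simp
qed auto

lemma cfg_values: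
  assumes "l < n"
  shows "cfg_pos n \<rho> (Suc l) = of_real \<rho> * cis (2 * pi * real l / real n)"
    "cfg_pos n \<rho> (n + 1 + 2 * l) = cis (2 * pi * real l / real n)"
    "cfg_pos n \<rho> (n + 2 + 2 * l) = cis (pi * real (2 * l + 1) / real n)"
    "cfg_mass n (m0, m1, m2, m3) (Suc l) = m1"
    "cfg_mass n (m0, m1, m2, m3) (n + 1 + 2 * l) = m2"
    "cfg_mass n (m0, m1, m2, m3) (n + 2 + 2 * l) = m3"
  using assms by (auto simp: cfg_pos_def cfg_mass_def mult_ac)

lemma cfg_values_0: "cfg_pos n \<rho> 0 = 0" "cfg_mass n (m0, m1, m2, m3) 0 = m0"
  by (auto simp: cfg_pos_def cfg_mass_def)

text \<open>The arbitrary summand \<open>g\<close> lets one lemma serve total mass, center of mass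
  and forces.\<close>

lemma sum_cfg:
  assumes "n > 0"
  shows "(\<Sum>i<1 + 3 * n. g (cfg_mass n (m0, m1, m2, m3) i) (cfg_pos n \<rho> i)) =
    g m0 0 + (\<Sum>z\<in>gon n 1. g m1 (of_real \<rho> * z)) + (\<Sum>z\<in>gon n 1. g m2 z) + (\<Sum>z\<in>gon n (- 1). g m3 z)"
proof -
  let ?g = "\<lambda>i. g (cfg_mass n (m0, m1, m2, m3) i) (cfg_pos n \<rho> i)"
  have "(\<Sum>i<1 + 3 * n. ?g i) = ?g 0 + (sum ?g (Suc ` {..<n}) +
     (sum ?g ((\<lambda>l. n + 1 + 2 * l) ` {..<n}) + sum ?g ((\<lambda>l. n + 2 + 2 * l) ` {..<n})))"
    unfolding cfg_index_decomp
    by (subst sum.insert sum.union_disjoint; auto; presburger?)+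
  also have "sum ?g (Suc ` {..<n}) = (\<Sum>l<n. g m1 (of_real \<rho> * cis (2 * pi * real l / real n)))"
    by (subst sum.reindex) (auto simp: cfg_values)
  also have "\<dots> = (\<Sum>z\<in>gon n 1. g m1 (of_real \<rho> * z))"
    by (rule sum.reindex_bij_betw[OF bij_betw_gon_even[OF assms]])
  also have "sum ?g ((\<lambda>l. n + 1 + 2 * l) ` {..<n}) = (\<Sum>l<n. g m2 (cis (2 * pi * real l / real n)))"
    by (subst sum.reindex) (auto simp: cfg_values(2,5)[simplified] intro!: inj_onI)
  also have "\<dots> = (\<Sum>z\<in>gon n 1. g m2 z)"
    by (rule sum.reindex_bij_betw[OF bij_betw_gon_even[OF assms]])
  also have "sum ?g ((\<lambda>l. n + 2 + 2 * l) ` {..<n}) = (\<Sum>l<n. g m3 (cis (pi * real (2 * l + 1) / real n)))"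
    by (subst sum.reindex) (auto simp: cfg_values(3,6)[simplified] intro!: inj_onI)
  also have "\<dots> = (\<Sum>z\<in>gon n (- 1). g m3 z)"
    by (rule sum.reindex_bij_betw[OF bij_betw_gon_odd[OF assms]])
  finally show ?thesis by (simp add: cfg_values_0 add.assoc)
qed

lemma cfg_pos_image:
  assumes "n > 0"
  shows "cfg_pos n \<rho> ` {..<1 + 3 * n} = insert 0 ((\<lambda>z. of_real \<rho> * z) ` gon n 1 \<union> gon n 1 \<union> gon n (- 1))"
proof -
  have "cfg_pos n \<rho> ` Suc ` {..<n} = (\<lambda>z. of_real \<rho> * z) ` gon n 1"
    unfolding bij_betw_imp_surj_on[OF bij_betw_gon_even[OF assms], symmetric] image_image
    by (intro image_cong refl) (simp add: cfg_values)
  moreover have "cfg_pos n \<rho> ` (\<lambda>l. n + 1 + 2 * l) ` {..<n} = gon n 1"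
    unfolding bij_betw_imp_surj_on[OF bij_betw_gon_even[OF assms], symmetric] image_image
    by (intro image_cong refl cfg_values) simp
  moreover have "cfg_pos n \<rho> ` (\<lambda>l. n + 2 + 2 * l) ` {..<n} = gon n (- 1)"
    unfolding bij_betw_imp_surj_on[OF bij_betw_gon_odd[OF assms], symmetric] image_image
    by (intro image_cong refl cfg_values) simp
  ultimately show ?thesis
    unfolding cfg_index_decomp image_insert image_Un by (simp add: cfg_values_0 Un_assoc)
qed

lemma card_gon: "n > 0 \<Longrightarrow> s \<noteq> 0 \<Longrightarrow> card (gon n s) = n"
  unfolding gon_def by (rule card_nth_roots)

lemma total_mass_cfg:
  assumes "n > 0"
  shows "total_mass (1 + 3 * n) (cfg_mass n (m0, m1, m2, m3)) = m0 + n * (m1 + m2 + m3)"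
  unfolding total_mass_def using sum_cfg[OF assms, where g = "\<lambda>m _. m"] assms
  by (simp add: card_gon algebra_simps)

lemma sum_gon: "n \<ge> 2 \<Longrightarrow> \<Sum>(gon n s) = 0"
  unfolding gon_def using sum_nth_roots[of n s] by simp

lemma center_of_mass_cfg:
  assumes "n \<ge> 2"
  shows "center_of_mass (1 + 3 * n) (cfg_mass n (m0, m1, m2, m3)) (cfg_pos n \<rho>) = 0"
  unfolding center_of_mass_def using assms sum_cfg[where g = "\<lambda>m z. of_real m * z" and n = n]
  by (simp add: sum_gon flip: sum_distrib_left mult.assoc)

text \<open>Injectivity is read off from the cardinality of the image: for \<open>\<rho> = 1\<close>
  the \<open>n\<close>-gon falls onto half of the \<open>2n\<close>-gon, otherwise the moduli
  differ.\<close>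

lemma is_config_cfg_iff:
  assumes "n > 0" "\<rho> > 0"
  shows "is_config (1 + 3 * n) (cfg_pos n \<rho>) \<longleftrightarrow> \<rho> \<noteq> 1"
proof -
  let ?S = "(\<lambda>z. of_real \<rho> * z) ` gon n 1"
  have cm: "cmod z = 1" if "z \<in> gon n 1 \<or> z \<in> gon n (- 1)" for z
    using that cmod_gon[OF assms(1)] by (auto)
  have fin: "finite ?S" "finite (gon n 1)" "finite (gon n (- 1))"
    using assms by (auto intro: finite_gon)
  have cS: "card ?S = n" using assms by (subst card_image) (auto simp: card_gon intro!: inj_onI)
  have 0: "0 \<notin> ?S \<union> gon n 1 \<union> gon n (- 1)"
    using assms by (auto simp: gon_def power_0_left)
  have "card (insert 0 (?S \<union> gon n 1 \<union> gon n (- 1))) = 1 + card (?S \<union> (gon n 1 \<union> gon n (- 1)))"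
    using 0 fin by (simp add: Un_assoc)
  moreover have c2: "card (gon n 1 \<union> gon n (- 1)) = 2 * n"
    using fin gon_disjoint assms by (subst card_Un_disjoint) (auto simp: card_gon)
  moreover have "card (?S \<union> (gon n 1 \<union> gon n (- 1))) = 3 * n" if "\<rho> \<noteq> 1"
  proof -
    have "?S \<inter> (gon n 1 \<union> gon n (- 1)) = {}"
    proof (intro equals0I)
      fix w assume "w \<in> ?S \<inter> (gon n 1 \<union> gon n (- 1))"
      then obtain z where "z \<in> gon n 1" "w = of_real \<rho> * z" "cmod w = 1" using cm by blast
      then show False using cm[of z] that assms(2) by (simp add: norm_mult)
    qed
    then show ?thesis using fin cS c2 by (subst card_Un_disjoint) auto
  qed
  moreover have "card (?S \<union> (gon n 1 \<union> gon n (- 1))) = 2 * n" if "\<rho> = 1"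
    using that c2 by (simp flip: Un_assoc)
  ultimately show ?thesis
    unfolding is_config_def inj_on_iff_eq_card[OF finite_lessThan] cfg_pos_image[OF assms(1)]
    using assms by (cases "\<rho> = 1") auto
qed

text \<open>By symmetry the force at the origin vanishes, and at any vertex it is radial and depends
  only on the polygon. This leaves one real equation per mass class. The cube comes from scaling the
  \<open>n\<close>-gon to radius \<open>1\<close>: the field contributes
  \<open>\<rho>\<^sup>2\<close>, the acceleration \<open>\<rho>\<close>.\<close>

lemma rel_eq_cfg_iff:
  assumes n: "n \<ge> 2" and \<rho>: "\<rho> > 0" and pos: "mass_system (m0, m1, m2, m3)"
  shows "is_rel_eq (1 + 3 * n) (cfg_mass n (m0, m1, m2, m3)) (cfg_pos n \<rho>) \<longleftrightarrow>
     m0 + m1 * gon_force n 1 1 + m2 * gon_force n 1 (1 / \<rho>) + m3 * gon_force n (- 1) (1 / \<rho>) = \<rho> ^ 3 \<and>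
     m0 + m1 * gon_force n 1 \<rho> + m2 * gon_force n 1 1 + m3 * gon_force n (- 1) 1 = 1 \<and>
     m0 + m1 * gon_force n (- 1) \<rho> + m2 * gon_force n (- 1) 1 + m3 * gon_force n 1 1 = 1"
    (is "_ \<longleftrightarrow> ?L1 = _ \<and> ?L2 = _ \<and> ?L3 = _")
proof -
  have n0: "n > 0" using n by simp
  define F where "F = (\<lambda>p. of_real m0 * grav p + of_real m1 * (\<Sum>z\<in>gon n 1. grav (p - of_real \<rho> * z))
     + of_real m2 * (\<Sum>z\<in>gon n 1. grav (p - z)) + of_real m3 * (\<Sum>z\<in>gon n (- 1). grav (p - z)))"
  have "is_rel_eq (1 + 3 * n) (cfg_mass n (m0, m1, m2, m3)) (cfg_pos n \<rho>) \<longleftrightarrow>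
     (\<forall>i<1 + 3 * n. F (cfg_pos n \<rho> i) = cfg_pos n \<rho> i)"
  proof (subst is_rel_eq_iff)
    show "cfg_mass n (m0, m1, m2, m3) i > 0" for i
      using pos by (auto simp: cfg_mass_def mass_system_def)
    show "(\<forall>i<1 + 3 * n. (\<Sum>j<1 + 3 * n. of_real (cfg_mass n (m0, m1, m2, m3) j) *
        grav (cfg_pos n \<rho> i - cfg_pos n \<rho> j)) = cfg_pos n \<rho> i) \<longleftrightarrow>
        (\<forall>i<1 + 3 * n. F (cfg_pos n \<rho> i) = cfg_pos n \<rho> i)"
      using sum_cfg[OF n0, where g = "\<lambda>m z. of_real m * grav (_ - z)"]
      by (simp add: F_def sum_distrib_left)
  qed
  also have "\<dots> \<longleftrightarrow> (\<forall>p\<in>cfg_pos n \<rho> ` {..<1 + 3 * n}. F p = p)"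
    by blast
  also have "\<dots> \<longleftrightarrow> F 0 = 0 \<and> (\<forall>v\<in>gon n 1. F (of_real \<rho> * v) = of_real \<rho> * v) \<and>
      (\<forall>v\<in>gon n 1. F v = v) \<and> (\<forall>v\<in>gon n (- 1). F v = v)"
    unfolding cfg_pos_image[OF n0] by auto
  also have "F 0 = 0"
  proof -
    have "(\<Sum>z\<in>gon n s. grav (0 - of_real x * z)) = 0" if "s\<^sup>2 = 1" "x > 0" for s x
    proof -
      have "(\<Sum>z\<in>gon n s. grav (0 - of_real x * z)) = (\<Sum>z\<in>gon n s. - (z / of_real (x\<^sup>2)))"
      proof (intro sum.cong refl)
        fix z assume "z \<in> gon n s"
        then have "cmod z = 1" using cmod_gon[OF n0] that by blast
        then show "grav (0 - of_real x * z) = - (z / of_real (x\<^sup>2))"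
          using that by (simp add: grav_minus grav_scale) (simp add: grav_def)
      qed
      also have "\<dots> = 0" using sum_gon[OF n] by (simp add: sum_negf flip: sum_divide_distrib)
      finally show ?thesis .
    qed
    from this[of _ 1] this[of 1 \<rho>] show ?thesis using \<rho> by (simp add: F_def)
  qed
  also have "(\<forall>v\<in>gon n 1. F (of_real \<rho> * v) = of_real \<rho> * v) \<longleftrightarrow> ?L1 = \<rho> ^ 3"
  proof -
    have "F (of_real \<rho> * v) = of_real \<rho> * v \<longleftrightarrow> ?L1 = \<rho> ^ 3" if v: "v \<in> gon n 1" for v
    proof -
      have c: "cmod v = 1" using cmod_gon[OF n0 v] by simp
      then have "v \<noteq> 0" by auto
      have g: "grav (of_real \<rho> * v) = v / of_real (\<rho>\<^sup>2)"
        using grav_scale[OF \<rho>, of v] c by (simp add: grav_def)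
      have "(\<Sum>z\<in>gon n s. grav (of_real \<rho> * v - of_real x * z)) = v * of_real (gon_force n s (x / \<rho>)) / of_real (\<rho>\<^sup>2)"
        if "s\<^sup>2 = 1" for s x
      proof -
        have "grav (of_real \<rho> * v - of_real x * z) = grav (v - of_real (x / \<rho>) * z) / of_real (\<rho>\<^sup>2)" for z
          using grav_scale[OF \<rho>, of "v - of_real (x / \<rho>) * z"] \<rho> by (simp add: algebra_simps)
        then have "(\<Sum>z\<in>gon n s. grav (of_real \<rho> * v - of_real x * z))
           = (\<Sum>z\<in>gon n s. grav (v - of_real (x / \<rho>) * z)) / of_real (\<rho>\<^sup>2)"
          by (simp only: sum_divide_distrib)
        then show ?thesis
          using sum_gon_grav_vertex[OF n0 that _ v, of "x / \<rho>"] by (simp only: power_one mult_1_right simp_thms)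
      qed
      from this[of 1 \<rho>] this[of 1 1] this[of "-1" 1] have "F (of_real \<rho> * v) = v * of_real (?L1 / \<rho>\<^sup>2)"
        unfolding F_def g using \<rho> by (simp add: field_simps)
      then have "F (of_real \<rho> * v) = of_real \<rho> * v \<longleftrightarrow> of_real (?L1 / \<rho>\<^sup>2) = complex_of_real \<rho>"
        using \<open>v \<noteq> 0\<close> by (simp only: mult.commute[of "of_real \<rho>"] mult_cancel_left simp_thms)
      also have "\<dots> \<longleftrightarrow> ?L1 / \<rho>\<^sup>2 = \<rho>" by (simp only: of_real_eq_iff)
      also have "\<dots> \<longleftrightarrow> ?L1 = \<rho> ^ 3" using \<rho> by (simp add: field_simps power2_eq_square power3_eq_cube)
      finally show ?thesis .
    qed
    moreover have "1 \<in> gon n 1" by (simp add: gon_def)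
    ultimately show ?thesis by blast
  qed
  also have "(\<forall>v\<in>gon n 1. F v = v) \<longleftrightarrow> ?L2 = 1"
  proof -
    have "F v = v \<longleftrightarrow> ?L2 = 1" if v: "v \<in> gon n 1" for v
    proof -
      have c: "cmod v = 1" using cmod_gon[OF n0 v] by simp
      then have "v \<noteq> 0" by auto
      have "F v = v * of_real ?L2"
        using sum_gon_grav_vertex[OF n0 _ _ v, of 1 \<rho>] sum_gon_grav_vertex[OF n0 _ _ v, of 1 1]
          sum_gon_grav_vertex[OF n0 _ _ v, of "- 1" 1] c
        by (simp add: F_def grav_def[of v] algebra_simps)
      then have "F v = v \<longleftrightarrow> v * of_real ?L2 = v * of_real 1" by simp
      also have "\<dots> \<longleftrightarrow> ?L2 = 1" using \<open>v \<noteq> 0\<close> by (simp only: mult_cancel_left of_real_eq_iff) simp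
      finally show ?thesis .
    qed
    moreover have "1 \<in> gon n 1" by (simp add: gon_def)
    ultimately show ?thesis by blast
  qed
  also have "(\<forall>v\<in>gon n (- 1). F v = v) \<longleftrightarrow> ?L3 = 1"
  proof -
    have "F v = v \<longleftrightarrow> ?L3 = 1" if v: "v \<in> gon n (- 1)" for v
    proof -
      have c: "cmod v = 1" using cmod_gon[OF n0 v] by simp
      then have "v \<noteq> 0" by auto
      have "F v = v * of_real ?L3"
        using sum_gon_grav_vertex[OF n0 _ _ v, of 1 \<rho>] sum_gon_grav_vertex[OF n0 _ _ v, of 1 1]
          sum_gon_grav_vertex[OF n0 _ _ v, of "- 1" 1] c
        by (simp add: F_def grav_def[of v] algebra_simps)
      then have "F v = v \<longleftrightarrow> v * of_real ?L3 = v * of_real 1" by simp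
      also have "\<dots> \<longleftrightarrow> ?L3 = 1" using \<open>v \<noteq> 0\<close> by (simp only: mult_cancel_left of_real_eq_iff) simp
      finally show ?thesis .
    qed
    moreover have "gon n (- 1) \<noteq> {}" using card_gon[OF n0, of "- 1"] n0 by auto
    ultimately show ?thesis by blast
  qed
  finally show ?thesis by simp
qed

section \<open>Really perverse relative equilibria\<close>

text \<open>The coefficient that multiplies the difference of the \<open>m1\<close> once the other
  mass differences are eliminated, as in \<open>linear_system_trivial\<close>.\<close>

definition perv_det :: "nat \<Rightarrow> real \<Rightarrow> real" where
  "perv_det n \<rho> = (2 * gon_force n 1 1 - 2 * n +
       (gon_force n 1 \<rho> - gon_force n (- 1) \<rho>) * (gon_force n 1 (1 / \<rho>) - gon_force n (- 1) (1 / \<rho>))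
         / (gon_force n (- 1) 1 - gon_force n 1 1)) * (gon_force n 1 1 + gon_force n (- 1) 1 - 2 * n)
     - (gon_force n 1 \<rho> + gon_force n (- 1) \<rho> - 2 * n) * (gon_force n 1 (1 / \<rho>) + gon_force n (- 1) (1 / \<rho>) - 2 * n)"

lemma gon_force_1_less:
  assumes "n \<ge> 2"
  shows "gon_force n 1 1 < gon_force n (- 1) 1"
  using gon_force_1_1[of n] gon_force_1_add[of n] csc_sum_double[OF assms] assms by simp

text \<open>In terms of \<open>s = d2 + d3\<close> and \<open>u = d2 - d3\<close>, the difference of
  the second and third equations determines \<open>u\<close> and their sum determines
  \<open>s\<close>, both as multiples of \<open>d1\<close>. The first equation then reads
  \<open>d1\<close> times the determinant.\<close>

lemma linear_system_trivial:
  fixes A B G0 G1 H0 H1 N d0 d1 d2 d3 :: real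
  assumes AB: "A < B"
    and det: "(2 * A - 2 * N + (G0 - G1) * (H0 - H1) / (B - A)) * (A + B - 2 * N)
                - (G0 + G1 - 2 * N) * (H0 + H1 - 2 * N) \<noteq> 0"
    and c: "A + B \<noteq> 2 * N"
    and e: "d0 + d1 * A + d2 * H0 + d3 * H1 = 0" "d0 + d1 * G0 + d2 * A + d3 * B = 0"
      "d0 + d1 * G1 + d2 * B + d3 * A = 0" "d0 + N * (d1 + d2 + d3) = 0"
  shows "d0 = 0 \<and> d1 = 0 \<and> d2 = 0 \<and> d3 = 0"
proof -
  define s u where "s = d2 + d3" and "u = d2 - d3"
  have d: "d2 = (s + u) / 2" "d3 = (s - u) / 2" "d0 = - N * (d1 + s)"
    using e(4) by (auto simp: s_def u_def algebra_simps)
  have u: "u = d1 * (G0 - G1) / (B - A)"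
    using e(2,3) AB unfolding d by (simp add: field_simps)
  have s: "s * (A + B - 2 * N) = - d1 * (G0 + G1 - 2 * N)"
    using e(2,3) unfolding d by (simp add: field_simps)
  have "2 * d1 * (A - N) + s * (H0 + H1 - 2 * N) + u * (H0 - H1) = 0"
    using e(1) unfolding d by (simp add: field_simps)
  then have "(A + B - 2 * N) * (2 * d1 * (A - N)) + s * (A + B - 2 * N) * (H0 + H1 - 2 * N)
      + (A + B - 2 * N) * u * (H0 - H1) = 0"
    by algebra
  then have "d1 * ((2 * A - 2 * N + (G0 - G1) * (H0 - H1) / (B - A)) * (A + B - 2 * N)
                - (G0 + G1 - 2 * N) * (H0 + H1 - 2 * N)) = 0"
    unfolding s u by (simp add: algebra_simps)
  then have "d1 = 0" using det by simp
  then have "s = 0" "u = 0" using s u c by auto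
  then show ?thesis using \<open>d1 = 0\<close> d by simp
qed

lemma not_really_perverse:
  assumes "n \<ge> 2" "n \<le> 236" "\<rho> > 0"
  shows "\<not> really_perverse n \<rho>"
proof
  assume "really_perverse n \<rho>"
  then obtain m0 m1 m2 m3 m0' m1' m2' m3' where
    cfg: "is_config (1 + 3 * n) (cfg_pos n \<rho>)" and
    pos: "mass_system (m0, m1, m2, m3)" "mass_system (m0', m1', m2', m3')" and
    ne: "(m0, m1, m2, m3) \<noteq> (m0', m1', m2', m3')" and
    tot: "total_mass (1 + 3 * n) (cfg_mass n (m0, m1, m2, m3)) = total_mass (1 + 3 * n) (cfg_mass n (m0', m1', m2', m3'))" and
    eq: "is_rel_eq (1 + 3 * n) (cfg_mass n (m0, m1, m2, m3)) (cfg_pos n \<rho>)"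
      "is_rel_eq (1 + 3 * n) (cfg_mass n (m0', m1', m2', m3')) (cfg_pos n \<rho>)"
    unfolding really_perverse_def Let_def by (metis prod_cases4)
  have n0: "n > 0" using assms by simp
  have \<rho>1: "\<rho> \<noteq> 1" using cfg is_config_cfg_iff[OF n0 assms(3)] by simp
  note AB = gon_force_1_less[OF assms(1)]
  have c: "gon_force n 1 1 + gon_force n (- 1) 1 < 2 * n"
    using gon_force_1_add[OF n0] csc_sum_less[of "2 * n"] assms by simp
  then have A: "gon_force n 1 1 < n" using AB by simp
  define \<sigma> where "\<sigma> = 1 / \<rho>"
  \<comment> \<open>Exactly one of the two radii lies below \<open>1\<close>, so each product below
    has factors of opposite sign in either case.\<close>
  have "(0 < \<rho> \<and> \<rho> < 1 \<and> \<sigma> > 1) \<or> (\<rho> > 1 \<and> 0 < \<sigma> \<and> \<sigma> < 1)"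
    using \<rho>1 assms(3) by (auto simp: \<sigma>_def)
  then have Q: "(gon_force n 1 \<rho> - gon_force n (- 1) \<rho>) * (gon_force n 1 \<sigma> - gon_force n (- 1) \<sigma>) < 0"
    and P: "(gon_force n 1 \<rho> + gon_force n (- 1) \<rho> - 2 * n) * (gon_force n 1 \<sigma> + gon_force n (- 1) \<sigma> - 2 * n) < 0"
    using gon_force_add_gt[OF n0, of \<rho>] gon_force_add_gt[OF n0, of \<sigma>]
      gon_force_add_neg[OF n0, of \<rho>] gon_force_add_neg[OF n0, of \<sigma>]
      gon_force_diff_pos[OF n0, of \<rho>] gon_force_diff_pos[OF n0, of \<sigma>]
      gon_force_diff_neg[OF n0, of \<rho>] gon_force_diff_neg[OF n0, of \<sigma>]
    by (auto simp: mult_less_0_iff)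
  have "(gon_force n 1 \<rho> - gon_force n (- 1) \<rho>) * (gon_force n 1 \<sigma> - gon_force n (- 1) \<sigma>)
     / (gon_force n (- 1) 1 - gon_force n 1 1) < 0"
    using Q AB by (intro divide_neg_pos) auto
  then have "(2 * gon_force n 1 1 - 2 * n + (gon_force n 1 \<rho> - gon_force n (- 1) \<rho>) * (gon_force n 1 \<sigma> - gon_force n (- 1) \<sigma>)
     / (gon_force n (- 1) 1 - gon_force n 1 1)) * (gon_force n 1 1 + gon_force n (- 1) 1 - 2 * n) > 0"
    using A c by (intro mult_neg_neg) auto
  then have det: "perv_det n \<rho> > 0"
    using P unfolding perv_det_def \<sigma>_def by linarith
  have "m0 - m0' = 0 \<and> m1 - m1' = 0 \<and> m2 - m2' = 0 \<and> m3 - m3' = 0"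
  proof (rule linear_system_trivial[OF AB])
    show "(2 * gon_force n 1 1 - 2 * real n + (gon_force n 1 \<rho> - gon_force n (- 1) \<rho>) * (gon_force n 1 \<sigma> - gon_force n (- 1) \<sigma>)
     / (gon_force n (- 1) 1 - gon_force n 1 1)) * (gon_force n 1 1 + gon_force n (- 1) 1 - 2 * real n)
     - (gon_force n 1 \<rho> + gon_force n (- 1) \<rho> - 2 * real n) * (gon_force n 1 \<sigma> + gon_force n (- 1) \<sigma> - 2 * real n) \<noteq> 0"
      using det unfolding perv_det_def \<sigma>_def by simp
    show "gon_force n 1 1 + gon_force n (- 1) 1 \<noteq> 2 * real n" using c by simp
    note E = eq(1)[unfolded rel_eq_cfg_iff[OF assms(1,3) pos(1)]] eq(2)[unfolded rel_eq_cfg_iff[OF assms(1,3) pos(2)]]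
    show "m0 - m0' + (m1 - m1') * gon_force n 1 1 + (m2 - m2') * gon_force n 1 \<sigma> + (m3 - m3') * gon_force n (- 1) \<sigma> = 0"
      "m0 - m0' + (m1 - m1') * gon_force n 1 \<rho> + (m2 - m2') * gon_force n 1 1 + (m3 - m3') * gon_force n (- 1) 1 = 0"
      "m0 - m0' + (m1 - m1') * gon_force n (- 1) \<rho> + (m2 - m2') * gon_force n (- 1) 1 + (m3 - m3') * gon_force n 1 1 = 0"
      using E by (auto simp: \<sigma>_def algebra_simps)
    show "m0 - m0' + real n * (m1 - m1' + (m2 - m2') + (m3 - m3')) = 0"
      using tot unfolding total_mass_cfg[OF n0] by (simp add: algebra_simps)
  qed
  then show False using ne by simp
qed

text \<open>The parameters \<open>e\<close> and \<open>2 * e\<close> supply the two distinct mass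
  systems on one line of solutions.\<close>

lemma exists_positive_perturbation:
  fixes a b c p q r :: real
  assumes "a > 0" "b > 0" "c > 0"
  shows "\<exists>e>0. a + e * p > 0 \<and> b + e * q > 0 \<and> c + e * r > 0 \<and>
     a + 2 * e * p > 0 \<and> b + 2 * e * q > 0 \<and> c + 2 * e * r > 0"
proof -
  have lim: "eventually (\<lambda>e. x + e * y > 0) (at_right 0)" "eventually (\<lambda>e. x + 2 * e * y > 0) (at_right 0)"
    if "x > 0" for x y :: real
  proof -
    have "((\<lambda>e. x + e * y) \<longlongrightarrow> x + 0 * y) (at_right 0)" "((\<lambda>e. x + 2 * e * y) \<longlongrightarrow> x + 2 * 0 * y) (at_right 0)"
      by (intro tendsto_intros)+
    then show "eventually (\<lambda>e. x + e * y > 0) (at_right 0)" "eventually (\<lambda>e. x + 2 * e * y > 0) (at_right 0)"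
      using that by (auto dest: order_tendstoD(1))
  qed
  have "eventually (\<lambda>e. e > 0 \<and> a + e * p > 0 \<and> b + e * q > 0 \<and> c + e * r > 0 \<and>
     a + 2 * e * p > 0 \<and> b + 2 * e * q > 0 \<and> c + 2 * e * r > 0) (at_right (0::real))"
    using lim assms by (auto intro!: eventually_conj simp: eventually_at_right_less)
  then show ?thesis
    by (auto dest!: eventually_happens simp: trivial_limit_at_right_real)
qed

lemma really_perverse_if_det_0:
  assumes n: "n \<ge> 2" and \<rho>: "0 < \<rho>" "\<rho> < 1" and det: "perv_det n \<rho> = 0"
  shows "really_perverse n \<rho>"
proof -
  have n0: "n > 0" using n by simp
  define A B G0 G1 H0 H1 where "A = gon_force n 1 1" and "B = gon_force n (- 1) 1"
    and "G0 = gon_force n 1 \<rho>" and "G1 = gon_force n (- 1) \<rho>"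
    and "H0 = gon_force n 1 (1 / \<rho>)" and "H1 = gon_force n (- 1) (1 / \<rho>)"
  note defs = A_def B_def G0_def G1_def H0_def H1_def
  have AB: "A < B" using gon_force_1_less[OF n] by (simp add: defs)
  have "csc_sum n \<ge> 0" unfolding csc_sum_def
    by (auto intro!: sum_nonneg sin_ge_zero simp: field_simps)
  then have "A \<ge> 0" using gon_force_1_1[OF n0] by (simp add: defs)
  have H: "H0 + H1 < 0" using gon_force_add_neg[OF n0, of "1 / \<rho>"] \<rho> by (simp add: defs)
  \<comment> \<open>For \<open>m1 = 0\<close> and equal masses \<open>m\<close> on the
    \<open>2n\<close>-gon, subtracting the two remaining equations gives
    \<open>m * D = 1 - \<rho> ^ 3\<close>; here \<open>\<rho> < 1\<close> makes \<open>m\<close>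
    positive.\<close>
  define D where "D = A + B - H0 - H1"
  have D: "D > 0" using AB \<open>A \<ge> 0\<close> H by (simp add: D_def)
  \<comment> \<open>\<open>(c, 0, m, m)\<close> solves the equations with \<open>m\<^sub>1 = 0\<close>, and \<open>(d0, 1, d2, d3)\<close> spans the homogeneous solutions.\<close>
  define m where "m = (1 - \<rho> ^ 3) / D"
  define c where "c = \<rho> ^ 3 - (H0 + H1) * m"
  have "\<rho> ^ 3 < 1" using \<rho> by (simp add: power_less_one_iff)
  then have m: "m > 0" using D by (simp add: m_def)
  have "(H0 + H1) * m < 0" using H m by (rule mult_neg_pos)
  then have c: "c > 0" using zero_less_power[OF \<rho>(1), of 3] unfolding c_def by linarith
  define u s d0 where "u = (G0 - G1) / (B - A)" and "s = (2 * A - G0 - G1 + u * (H0 - H1)) / D"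
    and "d0 = - (G0 + G1 + s * (A + B)) / 2"
  have uD: "u * (B - A) = G0 - G1" and sD: "s * D = 2 * A - G0 - G1 + u * (H0 - H1)" and mD: "m * D = 1 - \<rho> ^ 3"
    using AB D by (auto simp: u_def s_def m_def)
  define d2 d3 where "d2 = (s + u) / 2" and "d3 = (s - u) / 2"
  obtain e where e: "e > 0" "c + e * d0 > 0" "m + e * d2 > 0" "m + e * d3 > 0"
     "c + 2 * e * d0 > 0" "m + 2 * e * d2 > 0" "m + 2 * e * d3 > 0"
    using exists_positive_perturbation[OF c m m] by blast
  define mu where "mu = (\<lambda>e. (c + e * d0, e, m + e * d2, m + e * d3))"
  have pos: "mass_system (mu e)" "mass_system (mu (2 * e))"
    using e by (auto simp: mu_def mass_system_def)
  have "(2 * A - 2 * n + u * (H0 - H1)) * (A + B - 2 * n) - (G0 + G1 - 2 * n) * (H0 + H1 - 2 * n) = 0"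
    using det by (simp add: perv_det_def defs u_def)
  \<comment> \<open>The left side is the determinant, and the bracket is \<open>-2\<close> times the
    total mass of the homogeneous solution. So a zero determinant keeps the total mass fixed along
    the line.\<close>
  then have "D * ((G0 + G1 - 2 * n) + s * (A + B - 2 * n)) = 0"
    using sD unfolding D_def by algebra
  then have "G0 + G1 - 2 * n + s * (A + B - 2 * n) = 0" using D by simp
  then have T: "d0 + n * (1 + d2 + d3) = 0"
    by (simp add: d0_def d2_def d3_def field_simps)
  have tot: "total_mass (1 + 3 * n) (cfg_mass n (mu t)) = c + n * (2 * m)" for t
  proof -
    have "total_mass (1 + 3 * n) (cfg_mass n (mu t)) = c + n * (2 * m) + t * (d0 + n * (1 + d2 + d3))"
      unfolding mu_def total_mass_cfg[OF n0] by (simp add: algebra_simps)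
    then show ?thesis using T by simp
  qed
  have e1: "d0 + A + d2 * H0 + d3 * H1 = 0"
    using sD unfolding d0_def d2_def d3_def D_def by (simp add: field_simps)
  have e2: "d0 + G0 + d2 * A + d3 * B = 0"
    using uD unfolding d0_def d2_def d3_def D_def by (simp add: field_simps)
  have e3: "d0 + G1 + d2 * B + d3 * A = 0"
    using uD unfolding d0_def d2_def d3_def D_def by (simp add: field_simps)
  have f1: "c + m * H0 + m * H1 = \<rho> ^ 3" by (simp add: c_def algebra_simps)
  have f2: "c + m * A + m * B = 1" using mD by (simp add: c_def D_def algebra_simps)
  have "is_rel_eq (1 + 3 * n) (cfg_mass n (mu t)) (cfg_pos n \<rho>)" if "mass_system (mu t)" for t
    unfolding mu_def rel_eq_cfg_iff[OF n \<rho>(1) that[unfolded mu_def]]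
  proof (fold defs, intro conjI)
    have "c + t * d0 + t * A + (m + t * d2) * H0 + (m + t * d3) * H1 = (c + m * H0 + m * H1) + t * (d0 + A + d2 * H0 + d3 * H1)"
      by (simp add: algebra_simps)
    then show "c + t * d0 + t * A + (m + t * d2) * H0 + (m + t * d3) * H1 = \<rho> ^ 3" using f1 e1 by simp
    have "c + t * d0 + t * G0 + (m + t * d2) * A + (m + t * d3) * B = (c + m * A + m * B) + t * (d0 + G0 + d2 * A + d3 * B)"
      by (simp add: algebra_simps)
    then show "c + t * d0 + t * G0 + (m + t * d2) * A + (m + t * d3) * B = 1" using f2 e2 by simp
    have "c + t * d0 + t * G1 + (m + t * d2) * B + (m + t * d3) * A = (c + m * A + m * B) + t * (d0 + G1 + d2 * B + d3 * A)"
      by (simp add: algebra_simps)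
    then show "c + t * d0 + t * G1 + (m + t * d2) * B + (m + t * d3) * A = 1" using f2 e3 by simp
  qed
  moreover have "mu e \<noteq> mu (2 * e)" using e by (simp add: mu_def)
  moreover have "center_of_mass (1 + 3 * n) (cfg_mass n (mu t)) (cfg_pos n \<rho>) = 0" for t
    unfolding mu_def by (rule center_of_mass_cfg[OF n])
  moreover have "is_config (1 + 3 * n) (cfg_pos n \<rho>)"
    using is_config_cfg_iff[OF n0 \<rho>(1)] \<rho> by simp
  ultimately show ?thesis
    unfolding really_perverse_def Let_def using pos tot by metis
qed

section \<open>Existence of a zero of the determinant\<close>

text \<open>
  The continuous extension of \<open>gon_force n s (1 / x)\<close> to \<open>x = 0\<close>.
\<close>

definition gon_force_inv :: "nat \<Rightarrow> complex \<Rightarrow> real \<Rightarrow> real" where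
  "gon_force_inv n s x = x\<^sup>2 * Re (\<Sum>z\<in>gon n s. grav (of_real x - z))"

lemma gon_force_inverse:
  assumes "x > 0"
  shows "gon_force n s (1 / x) = gon_force_inv n s x"
proof -
  have "grav (of_real x - z) = grav (1 - of_real (1 / x) * z) / of_real (x\<^sup>2)" for z
    using grav_scale[OF assms, of "1 - of_real (1 / x) * z"] assms by (simp add: algebra_simps)
  then have "(\<Sum>z\<in>gon n s. grav (of_real x - z)) = (\<Sum>z\<in>gon n s. grav (1 - of_real (1 / x) * z)) / of_real (x\<^sup>2)"
    by (simp only: sum_divide_distrib)
  then show ?thesis
    using assms unfolding gon_force_def gon_force_inv_def by (simp only: Re_divide_of_real) simp
qed

lemma continuous_on_grav [continuous_intros]:
  assumes "continuous_on S f" "\<And>x. x \<in> S \<Longrightarrow> f x \<noteq> 0"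
  shows "continuous_on S (\<lambda>x. grav (f x))"
  unfolding grav_def using assms by (auto intro!: continuous_intros)

lemma sum_grav_continuous_on:
  assumes "\<And>x z. x \<in> S \<Longrightarrow> z \<in> Z \<Longrightarrow> of_real x * z \<noteq> 1 \<and> of_real x \<noteq> z"
  shows "continuous_on S (\<lambda>x. Re (\<Sum>z\<in>Z. grav (1 - of_real x * z)))"
    "continuous_on S (\<lambda>x. Re (\<Sum>z\<in>Z. grav (of_real x - z)))"
  using assms by (auto intro!: continuous_intros)

lemma gon_force_continuous_on:
  assumes "n > 0" "s\<^sup>2 = 1"
  shows "continuous_on {0..<1} (gon_force n s)" "continuous_on {0..<1} (gon_force_inv n s)"
proof -
  have ne: "of_real x * z \<noteq> 1 \<and> of_real x \<noteq> z" if "x \<in> {0..<1}" "z \<in> gon n s" for x :: real and z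
  proof -
    have "cmod z = 1" using cmod_gon[OF assms(1) that(2) assms(2)] .
    then have "cmod (of_real x * z) < 1" "cmod (of_real x) < cmod z" using that by (auto simp: norm_mult)
    then show ?thesis by fastforce
  qed
  note cont = sum_grav_continuous_on[of "{0..<1}" "gon n s", OF ne]
  show "continuous_on {0..<1} (gon_force n s)"
    unfolding gon_force_def by (rule cont)
  show "continuous_on {0..<1} (gon_force_inv n s)"
    unfolding gon_force_inv_def by (intro continuous_on_mult continuous_on_power continuous_on_id cont)
qed

text \<open>Without the vertex \<open>1\<close> the sums stay bounded near \<open>x = 1\<close>, so
  the factor \<open>(1 - x)\<^sup>2\<close> kills them.\<close>

lemma Re_sum_grav_tendsto:
  assumes "finite Z" "1 \<notin> Z"
  shows "((\<lambda>x. (1 - x)\<^sup>2 * Re (\<Sum>z\<in>Z. grav (1 - of_real x * z))) \<longlongrightarrow> 0) (at_left 1)"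
    "((\<lambda>x. (1 - x)\<^sup>2 * (x\<^sup>2 * Re (\<Sum>z\<in>Z. grav (of_real x - z)))) \<longlongrightarrow> 0) (at_left 1)"
proof -
  have "((\<lambda>x. (1 - x)\<^sup>2 * Re (\<Sum>z\<in>Z. grav (1 - of_real x * z))) \<longlongrightarrow>
      (1 - 1)\<^sup>2 * Re (\<Sum>z\<in>Z. grav (1 - of_real 1 * z))) (at_left 1)"
    unfolding grav_def by (intro tendsto_intros) (use assms in auto)
  then show "((\<lambda>x. (1 - x)\<^sup>2 * Re (\<Sum>z\<in>Z. grav (1 - of_real x * z))) \<longlongrightarrow> 0) (at_left 1)"
    by simp
  have "((\<lambda>x. (1 - x)\<^sup>2 * (x\<^sup>2 * Re (\<Sum>z\<in>Z. grav (of_real x - z)))) \<longlongrightarrow>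
      (1 - 1)\<^sup>2 * (1\<^sup>2 * Re (\<Sum>z\<in>Z. grav (of_real 1 - z)))) (at_left 1)"
    unfolding grav_def by (intro tendsto_intros) (use assms in auto)
  then show "((\<lambda>x. (1 - x)\<^sup>2 * (x\<^sup>2 * Re (\<Sum>z\<in>Z. grav (of_real x - z)))) \<longlongrightarrow> 0) (at_left 1)"
    by simp
qed

lemma gon_force_minus_tendsto:
  assumes "n > 0"
  shows "((\<lambda>x. (1 - x)\<^sup>2 * gon_force n (- 1) x) \<longlongrightarrow> 0) (at_left 1)"
    "((\<lambda>x. (1 - x)\<^sup>2 * gon_force_inv n (- 1) x) \<longlongrightarrow> 0) (at_left 1)"
  unfolding gon_force_def gon_force_inv_def
  using Re_sum_grav_tendsto[OF finite_gon[OF assms], of "- 1"] by (auto simp: gon_def)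

text \<open>Only the colliding vertex \<open>1\<close> survives the scaling; its attraction is
  \<open>1 / (1 - x)\<^sup>2\<close>, with the sign reversed when the roles of the two points are
  exchanged.\<close>

lemma gon_force_plus_tendsto:
  assumes "n > 0"
  shows "((\<lambda>x. (1 - x)\<^sup>2 * gon_force n 1 x) \<longlongrightarrow> 1) (at_left 1)"
    "((\<lambda>x. (1 - x)\<^sup>2 * gon_force_inv n 1 x) \<longlongrightarrow> - 1) (at_left 1)"
proof -
  let ?Z = "gon n 1 - {1}"
  have fin: "finite ?Z" using finite_gon[OF assms] by simp
  have split: "sum f (gon n 1) = f 1 + sum f ?Z" for f :: "complex \<Rightarrow> complex"
    using finite_gon[OF assms] by (intro sum.remove) (auto simp: gon_def)
  have g: "(1 - x)\<^sup>2 * Re (grav (1 - of_real x)) = 1" "(1 - x)\<^sup>2 * Re (grav (of_real x - 1)) = - 1" if "x < 1" for x :: real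
  proof -
    have "grav (1 - of_real x) = of_real (1 - x) / of_real (\<bar>1 - x\<bar> ^ 3)"
      unfolding grav_def norm_of_real[symmetric, where 'a = complex] by simp
    also have "\<dots> = of_real (1 / (1 - x)\<^sup>2)" using that by (simp add: power2_eq_square power3_eq_cube)
    finally have 1: "grav (1 - of_real x) = of_real (1 / (1 - x)\<^sup>2)" .
    then show "(1 - x)\<^sup>2 * Re (grav (1 - of_real x)) = 1" using that by simp
    have "grav (of_real x - 1) = - grav (1 - of_real x)" by (simp flip: grav_minus)
    then show "(1 - x)\<^sup>2 * Re (grav (of_real x - 1)) = - 1" unfolding 1 using that by simp
  qed
  have "((\<lambda>x. 1 + (1 - x)\<^sup>2 * Re (\<Sum>z\<in>?Z. grav (1 - of_real x * z))) \<longlongrightarrow> 1 + 0) (at_left 1)"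
    using Re_sum_grav_tendsto[OF fin] by (intro tendsto_intros) auto
  moreover have "eventually (\<lambda>x. 1 + (1 - x)\<^sup>2 * Re (\<Sum>z\<in>?Z. grav (1 - of_real x * z)) = (1 - x)\<^sup>2 * gon_force n 1 x) (at_left 1)"
    unfolding gon_force_def split using g by (auto simp: eventually_at_filter distrib_left)
  ultimately show "((\<lambda>x. (1 - x)\<^sup>2 * gon_force n 1 x) \<longlongrightarrow> 1) (at_left 1)"
    by (auto intro: Lim_transform_eventually)
  have "((\<lambda>x. - x\<^sup>2 + (1 - x)\<^sup>2 * (x\<^sup>2 * Re (\<Sum>z\<in>?Z. grav (of_real x - z)))) \<longlongrightarrow> - 1\<^sup>2 + 0) (at_left 1)"
    using Re_sum_grav_tendsto[OF fin] by (intro tendsto_intros) auto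
  moreover have "eventually (\<lambda>x. - x\<^sup>2 + (1 - x)\<^sup>2 * (x\<^sup>2 * Re (\<Sum>z\<in>?Z. grav (of_real x - z))) = (1 - x)\<^sup>2 * gon_force_inv n 1 x) (at_left 1)"
  proof -
    have "- x\<^sup>2 + (1 - x)\<^sup>2 * (x\<^sup>2 * Re (\<Sum>z\<in>?Z. grav (of_real x - z))) = (1 - x)\<^sup>2 * gon_force_inv n 1 x" if "x < 1" for x
    proof -
      have "(1 - x)\<^sup>2 * gon_force_inv n 1 x = x\<^sup>2 * ((1 - x)\<^sup>2 * Re (grav (of_real x - 1))) +
         (1 - x)\<^sup>2 * (x\<^sup>2 * Re (\<Sum>z\<in>?Z. grav (of_real x - z)))"
        unfolding gon_force_inv_def split by (simp only: plus_complex.sel distrib_left mult.left_commute)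
      then show ?thesis unfolding g[OF that] by simp
    qed
    then show ?thesis by (auto simp: eventually_at_filter)
  qed
  ultimately show "((\<lambda>x. (1 - x)\<^sup>2 * gon_force_inv n 1 x) \<longlongrightarrow> - 1) (at_left 1)"
    by (auto intro: Lim_transform_eventually)
qed

lemma exists_det_root:
  assumes n: "n \<ge> 2" and A: "gon_force n 1 1 \<noteq> n" and c: "gon_force n 1 1 + gon_force n (- 1) 1 > 2 * n"
  shows "\<exists>\<rho>. 0 < \<rho> \<and> \<rho> < 1 \<and> perv_det n \<rho> = 0"
proof -
  have n0: "n > 0" using n by simp
  define A B where "A = gon_force n 1 1" and "B = gon_force n (- 1) 1"
  have AB: "A < B" using gon_force_1_less[OF n] by (simp add: A_def B_def)
  define C where "C = A + B - 2 * n"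
  have C: "C > 0" using c by (simp add: C_def A_def B_def)
  let ?G = "gon_force n" and ?H = "gon_force_inv n"
  define E where "E = (\<lambda>x. (2 * A - 2 * n + (?G 1 x - ?G (- 1) x) * (?H 1 x - ?H (- 1) x) / (B - A)) * C
     - (?G 1 x + ?G (- 1) x - 2 * n) * (?H 1 x + ?H (- 1) x - 2 * n))"
  have E: "perv_det n x = E x" if "x > 0" for x
    using gon_force_inverse[OF that, of n] by (simp add: perv_det_def E_def A_def B_def C_def)
  have "continuous_on {0..<1} E"
    unfolding E_def using gon_force_continuous_on[OF n0] AB by (auto intro!: continuous_intros)
  \<comment> \<open>At \<open>x = 0\<close> each of the two polygons attracts with strength
    \<open>n\<close>, so their difference is \<open>0\<close> and their sum is \<open>2 * n\<close>;
    this removes all the other terms.\<close>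
  have E0: "E 0 = (2 * A - 2 * n) * C"
    using n0 by (simp add: E_def gon_force_inv_def gon_force_def card_gon grav_def)
  define e where "e = (\<lambda>x::real. (1 - x)\<^sup>2)"
  have e0: "(e \<longlongrightarrow> 0) (at_left 1)"
  proof -
    have "(e \<longlongrightarrow> (1 - 1)\<^sup>2) (at_left 1)" unfolding e_def by (intro tendsto_intros)
    then show ?thesis by simp
  qed
  have lims: "((\<lambda>x. e x * ?G 1 x) \<longlongrightarrow> 1) (at_left 1)" "((\<lambda>x. e x * ?H 1 x) \<longlongrightarrow> - 1) (at_left 1)"
    "((\<lambda>x. e x * ?G (- 1) x) \<longlongrightarrow> 0) (at_left 1)" "((\<lambda>x. e x * ?H (- 1) x) \<longlongrightarrow> 0) (at_left 1)"
    using gon_force_plus_tendsto[OF n0] gon_force_minus_tendsto[OF n0] by (simp_all add: e_def)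
  have "((\<lambda>x. ((2 * A - 2 * n) * (e x * e x) + (e x * ?G 1 x - e x * ?G (- 1) x) * (e x * ?H 1 x - e x * ?H (- 1) x) / (B - A)) * C
     - (e x * ?G 1 x + e x * ?G (- 1) x - 2 * real n * e x) * (e x * ?H 1 x + e x * ?H (- 1) x - 2 * real n * e x)) \<longlongrightarrow>
     ((2 * A - 2 * n) * (0 * 0) + (1 - 0) * (- 1 - 0) / (B - A)) * C - (1 + 0 - 2 * real n * 0) * (- 1 + 0 - 2 * real n * 0)) (at_left 1)"
    using AB by (intro tendsto_intros lims e0) auto
  also have "(\<lambda>x. ((2 * A - 2 * n) * (e x * e x) + (e x * ?G 1 x - e x * ?G (- 1) x) * (e x * ?H 1 x - e x * ?H (- 1) x) / (B - A)) * C
     - (e x * ?G 1 x + e x * ?G (- 1) x - 2 * real n * e x) * (e x * ?H 1 x + e x * ?H (- 1) x - 2 * real n * e x)) = (\<lambda>x. (e x)\<^sup>2 * E x)"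
    unfolding E_def by (intro ext) (simp add: power2_eq_square algebra_simps diff_divide_distrib add_divide_distrib)
  \<comment> \<open>The limit is \<open>1 - C / (B - A)\<close>, which by definition of
    \<open>C\<close> has the sign opposite to that of \<open>E 0\<close>.\<close>
  also have "((2 * A - 2 * n) * (0 * 0) + (1 - 0) * (- 1 - 0) / (B - A)) * C - (1 + 0 - 2 * real n * 0) * (- 1 + 0 - 2 * real n * 0)
      = - (2 * A - 2 * n) / (B - A)"
    using AB by (simp add: C_def field_simps)
  finally have lim: "((\<lambda>x. (e x)\<^sup>2 * E x) \<longlongrightarrow> - (2 * A - 2 * n) / (B - A)) (at_left 1)" .
  have "eventually (\<lambda>x. 0 < x \<and> x < (1::real)) (at_left 1)"
    by (auto intro!: eventually_conj eventually_at_leftI[of 0])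
  moreover have "eventually (\<lambda>x. E 0 * ((e x)\<^sup>2 * E x) < 0) (at_left 1)"
  proof (rule order_tendstoD(2))
    show "((\<lambda>x. E 0 * ((e x)\<^sup>2 * E x)) \<longlongrightarrow> E 0 * (- (2 * A - 2 * n) / (B - A))) (at_left 1)"
      by (intro tendsto_intros lim)
    have "E 0 * (- (2 * A - 2 * n) / (B - A)) = - ((2 * A - 2 * n)\<^sup>2 * C / (B - A))"
      unfolding E0 using AB by (simp add: power2_eq_square field_simps)
    moreover have "(2 * A - 2 * n)\<^sup>2 * C / (B - A) > 0"
      using A AB C by (simp add: A_def)
    ultimately show "E 0 * (- (2 * A - 2 * n) / (B - A)) < 0" by simp
  qed
  ultimately have "eventually (\<lambda>x. (0 < x \<and> x < 1) \<and> E 0 * ((e x)\<^sup>2 * E x) < 0) (at_left 1)"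
    by (rule eventually_conj)
  then obtain b where b: "0 < b" "b < 1" "E 0 * ((e b)\<^sup>2 * E b) < 0"
    by (auto dest!: eventually_happens simp: trivial_limit_at_left_real)
  then have "(e b)\<^sup>2 * (E 0 * E b) < 0" by (simp add: mult_ac)
  then have sgn: "E 0 * E b < 0" by (simp add: mult_less_0_iff)
  have cont: "continuous_on {0..b} E"
    using \<open>continuous_on {0..<1} E\<close> b by (auto intro: continuous_on_subset)
  have "\<exists>x\<ge>0. x \<le> b \<and> E x = 0"
  proof (cases "E 0 < 0")
    case True
    then have "0 \<le> E b" using sgn by (simp add: mult_less_0_iff)
    then show ?thesis using IVT'[OF _ _ _ cont] True b by auto
  next
    case False
    then have "E b \<le> 0" "0 \<le> E 0" using sgn by (auto simp: mult_less_0_iff)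
    then show ?thesis using IVT2'[OF _ _ _ cont] b by auto
  qed
  then obtain x where x: "0 \<le> x" "x \<le> b" "E x = 0" by blast
  moreover have "x \<noteq> 0" using x sgn by auto
  ultimately show ?thesis using E[of x] b by (intro exI[of _ x]) auto
qed

theorem theorem1:
  fixes n :: nat
  assumes "n \<ge> 2"
  shows "(n \<ge> 237 \<longrightarrow> (\<exists>\<rho>>0. really_perverse n \<rho>)) \<and>
         (n \<le> 236 \<longrightarrow> \<not> (\<exists>\<rho>>0. really_perverse n \<rho>))"
proof (intro conjI impI)
  assume n: "n \<ge> 237"
  have "gon_force n 1 1 + gon_force n (- 1) 1 > 2 * n"
    using gon_force_1_add[of n] csc_sum_greater[of "2 * n"] n by simp
  \<comment> \<open>The same numerical threshold, now applied to \<open>n\<close> instead of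
    \<open>2 * n\<close>, excludes equality.\<close>
  moreover have "gon_force n 1 1 \<noteq> n"
    using gon_force_1_1[of n] csc_sum_greater[of n] csc_sum_less[of n] n by (cases "n \<le> 472") auto
  ultimately show "\<exists>\<rho>>0. really_perverse n \<rho>"
    using exists_det_root[OF assms] really_perverse_if_det_0[OF assms] by blast
next
  assume "n \<le> 236"
  then show "\<not> (\<exists>\<rho>>0. really_perverse n \<rho>)"
    using not_really_perverse[OF assms] by blast
qed

end
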